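(* For every real $k\in(0,1)$, $$\sum_{n=0}^\infty \binom{2n}{n}^2 P_n\!\left(\frac{-k^4+6k^3-2k+1}{(k^2+1)(k^2+2k-1)}\right)\left(\frac{(k^2+1)(k^2+2k-1)}{16(k+1)^2}\right)^n\bigl(C_3n^3+C_2n^2+C_1n+C_0\bigr)=\frac{2(k+1)^3(k^2+1)}{\pi},$$ where $$C_3=4(k-1)^2k^2(k^2+3k+4)^2,$$ $$C_2=12(k-1)k(k^6+5k^5+10k^4+10k^3+5k^2-3k+4),$$ $$C_1=9k^8+36k^7+37k^6+8k^5-9k^4-56k^3+63k^2-28k+4,$$ $$C_0=(k^2+2k-1)^2(2k^4+3k^2-2k+1).$$ At the single value $k=\sqrt2-1$ (where $k^2+2k-1=0$), the product $P_n(\cdot)\,(\cdot)^n$ in each summand is understood as its limit as $k\to\sqrt2-1$.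
   Context: $P_n$ denotes the $n$-th Legendre polynomial, $P_n(x)={}_2F_1\bigl(-n,n+1;1;\tfrac{1-x}{2}\bigr)$, evaluated at any real $x$ (possibly $|x|>1$). *)

theory Defs
  imports "HOL-Analysis.Analysis"
begin

text \<open>
  The Gauss hypergeometric series is the library's \<open>fps_hypergeo\<close> with scaling parameter 1.
  For upper parameter \<open>- n\<close> it terminates, so its evaluation is meaningful for every real
  argument, also outside the disc of convergence of the general series.
\<close>

definition legendre :: "nat \<Rightarrow> real \<Rightarrow> real" where
  "legendre n x = eval_fps (fps_hypergeo [- real n, real n + 1] [1] 1) ((1 - x) / 2)"

definition arg_num :: "real \<Rightarrow> real" where
  "arg_num k = - (k^4) + 6 * k^3 - 2 * k + 1"

definition arg_den :: "real \<Rightarrow> real" where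
  "arg_den k = (k^2 + 1) * (k^2 + 2 * k - 1)"

definition legendre_power :: "nat \<Rightarrow> real \<Rightarrow> real" where
  "legendre_power n k =
     legendre n (arg_num k / arg_den k) * (arg_den k / (16 * (k + 1)^2)) ^ n"

text \<open>
  In \<open>{0<..<1}\<close> the denominator \<open>arg_den\<close> vanishes only at \<open>sqrt 2 - 1\<close>; there the product is
  replaced by its (two-sided) limit, which exists by \<open>legendre_power_tendsto\<close> below.
\<close>

definition legendre_power_ext :: "nat \<Rightarrow> real \<Rightarrow> real" where
  "legendre_power_ext n k =
     (if k = sqrt 2 - 1 then Lim (at (sqrt 2 - 1)) (legendre_power n) else legendre_power n k)"

definition C3 :: "real \<Rightarrow> real" where
  "C3 k = 4 * (k - 1)^2 * k^2 * (k^2 + 3 * k + 4)^2"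

definition C2 :: "real \<Rightarrow> real" where
  "C2 k = 12 * (k - 1) * k
     * (k^6 + 5 * k^5 + 10 * k^4 + 10 * k^3 + 5 * k^2 - 3 * k + 4)"

definition C1 :: "real \<Rightarrow> real" where
  "C1 k = 9 * k^8 + 36 * k^7 + 37 * k^6 + 8 * k^5 - 9 * k^4 - 56 * k^3 + 63 * k^2 - 28 * k + 4"

definition C0 :: "real \<Rightarrow> real" where
  "C0 k = (k^2 + 2 * k - 1)^2 * (2 * k^4 + 3 * k^2 - 2 * k + 1)"

lemma legendre_eq_sum:
  "legendre n x =
     (\<Sum>j\<le>n. pochhammer (- real n) j * pochhammer (real n + 1) j / (fact j * fact j)
              * ((1 - x) / 2) ^ j)"
proof -
  have "pochhammer (- real n) j = 0" if "j \<notin> {..n}" for j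
    using that by (simp add: pochhammer_of_nat_eq_0_iff)
  then have "legendre n x =
     (\<Sum>j\<le>n. fps_nth (fps_hypergeo [- real n, real n + 1] [1] 1) j * ((1 - x) / 2) ^ j)"
    unfolding legendre_def eval_fps_def by (intro suminf_finite) auto
  then show ?thesis
    by (simp flip: pochhammer_fact)
qed

lemma arg_den_eq_0_iff:
  assumes "0 < k"
  shows "arg_den k = 0 \<longleftrightarrow> k = sqrt 2 - 1"
proof -
  have "k^2 + 1 \<noteq> 0"
    by (simp add: add_nonneg_eq_0_iff)
  moreover have "k^2 + 2 * k - 1 = 0 \<longleftrightarrow> (k + 1)^2 = 2"
    by (simp add: power2_eq_square algebra_simps)
  moreover have "(k + 1)^2 = 2 \<longleftrightarrow> k + 1 = sqrt 2"
    using assms real_sqrt_unique[of "k + 1" 2] by auto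
  ultimately show ?thesis
    by (auto simp: arg_den_def)
qed

lemma legendre_power_eq:
  assumes "arg_den k \<noteq> 0"
  shows "legendre_power n k =
     (\<Sum>j\<le>n. pochhammer (- real n) j * pochhammer (real n + 1) j / (fact j * fact j)
              * ((arg_den k - arg_num k) / 2) ^ j * arg_den k ^ (n - j)) / (16 * (k + 1)^2) ^ n"
proof -
  have "((1 - arg_num k / arg_den k) / 2) ^ j * arg_den k ^ n =
      ((arg_den k - arg_num k) / 2) ^ j * arg_den k ^ (n - j)" if "j \<le> n" for j
  proof -
    have "arg_den k ^ n = arg_den k ^ j * arg_den k ^ (n - j)"
      using that by (simp flip: power_add)
    moreover have "(1 - arg_num k / arg_den k) / 2 * arg_den k = (arg_den k - arg_num k) / 2"
      using assms by (simp add: field_simps)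
    then have "((1 - arg_num k / arg_den k) / 2) ^ j * arg_den k ^ j
        = ((arg_den k - arg_num k) / 2) ^ j"
      by (metis power_mult_distrib)
    ultimately show ?thesis
      by (simp only: mult.assoc[symmetric])
  qed
  then show ?thesis
    unfolding legendre_power_def legendre_eq_sum power_divide[of "arg_den k"]
    by (simp only: times_divide_eq_right sum_distrib_right mult.assoc)
      (simp cong: sum.cong_simp)
qed

lemma legendre_power_tendsto:
  "(legendre_power n \<longlongrightarrow> Lim (at (sqrt 2 - 1)) (legendre_power n)) (at (sqrt 2 - 1))"
proof -
  let ?k0 = "sqrt 2 - 1 :: real"
  define f where "f k =
     (\<Sum>j\<le>n. pochhammer (- real n) j * pochhammer (real n + 1) j / (fact j * fact j)
              * ((arg_den k - arg_num k) / 2) ^ j * arg_den k ^ (n - j)) / (16 * (k + 1)^2) ^ n"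
    for k :: real
  have "isCont f ?k0"
    unfolding f_def arg_den_def arg_num_def by (intro continuous_intros) auto
  then have f_lim: "(f \<longlongrightarrow> f ?k0) (at ?k0)"
    by (simp add: isCont_def)
  have "eventually (\<lambda>k. k \<in> {0<..}) (at ?k0)"
    by (intro eventually_at_in_open') auto
  moreover have "eventually (\<lambda>k. k \<noteq> ?k0) (at ?k0)"
    by (simp add: eventually_at_filter)
  ultimately have "eventually (\<lambda>k. f k = legendre_power n k) (at ?k0)"
    by eventually_elim (simp add: f_def legendre_power_eq arg_den_eq_0_iff)
  with f_lim have "(legendre_power n \<longlongrightarrow> f ?k0) (at ?k0)"
    using Lim_transform_eventually by blast
  then show ?thesis
    using tendsto_Lim[OF trivial_limit_at] by force
qed

end

theory Submission
  imports Defs "HOL-Real_Asymp.Real_Asymp"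
begin

text \<open>
  Put \<open>X = k\<^sup>2\<close>, \<open>Y = ((1 - k) / (1 + k))\<^sup>2\<close>, \<open>U = X (1 - Y)\<close>, \<open>V = Y (1 - X)\<close>, and let \<open>u n\<close> be the square of
  \<open>binomial (2n) n / 4 ^ n\<close>. The n-th summand without the cubic factor is \<open>u n * Q n\<close>, where
  \<open>Q n = (\<Sum>m. (binomial n m)\<^sup>2 U ^ m V ^ (n - m))\<close>; in this form nothing singular happens at
  \<open>k = sqrt 2 - 1\<close>. Brafman's formula gives \<open>(\<Sum>n. u n * Q n) = F X * F Y\<close>, with F the hypergeometric
  series of parameters 1/2, 1/2; 1. Replacing (U, V) by (t U, t V) and applying t d/dt up to three
  times at t = 1 inserts the powers of n. With the flux \<open>F1 x = x (1 - x) F' x\<close> the result is a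
  combination of \<open>F X F Y\<close>, \<open>F1 X F Y\<close>, \<open>F X F1 Y\<close>, \<open>F1 X F1 Y\<close>. The given cubic polynomial makes the last
  one cancel and leaves a multiple of a Wronskian that, by Landen's transformation and Legendre's
  relation, equals \<open>1 / pi\<close>.
\<close>

subsection \<open>The hypergeometric series and its flux\<close>

definition cbin2 :: "nat \<Rightarrow> real" where
  "cbin2 n = (real ((2 * n) choose n) / 4 ^ n)^2"

text \<open>For |x| < 1 this is (2 / pi) K, where K is the complete elliptic integral of the first
  kind with squared modulus x.\<close>

definition ell :: "real \<Rightarrow> real" where
  "ell x = (\<Sum>n. cbin2 n * x ^ n)"

text \<open>On |x| < 1 this is the antiderivative of \<open>ell x / 4\<close> vanishing at 0. It
  equals x (1 - x) ell' x there, which is the hypergeometric equation in self-adjoint form, (x (1 -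
  x) F')' = F / 4. Working with the flux avoids second derivatives.\<close>

definition ell_flux :: "real \<Rightarrow> real" where
  "ell_flux x = (\<Sum>n. cbin2 n / (4 * real (Suc n)) * x ^ Suc n)"

lemma cbin2_0 [simp]: "cbin2 0 = 1"
  by (simp add: cbin2_def)

lemma cbin2_pos: "0 < cbin2 n"
  by (simp add: cbin2_def)

lemma cbin2_Suc: "(real n + 1)^2 * cbin2 (Suc n) = (real n + 1/2)^2 * cbin2 n"
proof -
  have b: "real ((2 * m) choose m) = fact (2 * m) / (fact m * fact m)" for m
    by (simp add: binomial_fact)
  have "(real n + 1) * real ((2 * Suc n) choose (Suc n)) = 2 * (2 * real n + 1) * real ((2 * n) choose n)"
  proof -
    define a where "a = real n + 1"
    have a: "a \<noteq> 0" "real n + 1 = a" "2 * real n + 1 = 2 * a - 1" "fact (Suc n) = a * (fact n :: real)"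
      "fact (2 * Suc n) = (2 * a) * (2 * a - 1) * (fact (2 * n) :: real)"
      by (simp_all add: a_def algebra_simps)
    have "a * ((2 * a) * (2 * a - 1) * g / ((a * f) * (a * f))) = 2 * (2 * a - 1) * (g / (f * f))" for f g :: real
      using a(1) by simp
    then show ?thesis
      unfolding b a .
  qed
  then have "(real n + 1) * (real ((2 * Suc n) choose (Suc n)) / 4 ^ Suc n)
      = (real n + 1/2) * (real ((2 * n) choose n) / 4 ^ n)"
    by (simp add: field_simps)
  then show ?thesis
    unfolding cbin2_def power_mult_distrib[symmetric] by simp
qed

section \<open>Monotonicity and Wallis asymptotics of the coefficients\<close>

lemma cbin2_Suc_le: "cbin2 (Suc n) \<le> cbin2 n"
proof -
  have "(real n + 1)^2 * cbin2 (Suc n) \<le> (real n + 1)^2 * cbin2 n"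
    unfolding cbin2_Suc using cbin2_pos[of n] by (intro mult_right_mono power_mono) auto
  then show ?thesis by simp
qed

lemma cbin2_le_1: "cbin2 n \<le> 1"
  using lift_Suc_antimono_le[of cbin2 0 n] cbin2_Suc_le by simp

text \<open>By \<open>cbin2_Suc\<close>, passing from n to n + 1 multiplies
  \<open>cbin2 n * (2 * real n + 1)\<close> by the inverse of the next Wallis factor.\<close>

lemma cbin2_wallis:
  "cbin2 n * (2 * real n + 1) * (\<Prod>k=1..n. (4 * real k^2) / (4 * real k^2 - 1)) = 1"
proof (induction n)
  case (Suc n)
  define a where "a = real n + 1/2"
  have a: "a > 0" "2 * real n + 1 = 2 * a" "2 * real (Suc n) + 1 = 2 * a + 2" "4 * real (Suc n)^2 - 1 = 2 * a * (2 * a + 2)"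
    by (simp_all add: a_def power2_eq_square algebra_simps)
  have "cbin2 (Suc n) * real (Suc n)^2 = a^2 * cbin2 n"
    using cbin2_Suc[of n] by (simp add: a_def algebra_simps)
  then have "cbin2 (Suc n) * (2 * real (Suc n) + 1) * (4 * real (Suc n)^2 / (4 * real (Suc n)^2 - 1))
      = 4 * (a^2 * cbin2 n) * (2 * a + 2) / (2 * a * (2 * a + 2))"
    unfolding a by (simp add: ac_simps)
  also have "\<dots> = cbin2 n * (2 * real n + 1)"
    using a(1) unfolding a(2) by (simp add: divide_simps power2_eq_square)
  finally have "cbin2 (Suc n) * (2 * real (Suc n) + 1) * (4 * real (Suc n)^2 / (4 * real (Suc n)^2 - 1))
      * (\<Prod>k=1..n. (4 * real k^2) / (4 * real k^2 - 1)) = 1"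
    using Suc.IH by simp
  moreover have "(\<Prod>k=1..Suc n. (4 * real k^2) / (4 * real k^2 - 1))
      = (4 * real (Suc n)^2 / (4 * real (Suc n)^2 - 1)) * (\<Prod>k=1..n. (4 * real k^2) / (4 * real k^2 - 1))"
    by (simp only: prod.cl_ivl_Suc mult.commute) simp
  ultimately show ?case
    by (simp only: mult.assoc)
qed simp

text \<open>The partial Wallis products tend to pi / 2. This limit is where pi enters the final
  formula.\<close>

lemma n_cbin2_tendsto: "(\<lambda>n. real n * cbin2 n) \<longlonglongrightarrow> 1 / pi"
proof -
  let ?w = "\<lambda>n. \<Prod>k=1..n. (4 * real k^2) / (4 * real k^2 - 1)"
  have "real n * cbin2 n = real n / (2 * real n + 1) * inverse (?w n)" for n
  proof -
    have "inverse (?w n) = cbin2 n * (2 * real n + 1)"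
      using cbin2_wallis[of n] by (intro inverse_unique) (simp add: ac_simps)
    then show ?thesis by simp
  qed
  moreover have "(\<lambda>n. real n / (2 * real n + 1) * inverse (?w n)) \<longlonglongrightarrow> 1/2 * inverse (pi / 2)"
    by (intro tendsto_mult tendsto_inverse wallis) (real_asymp | simp)+
  ultimately show ?thesis by simp
qed

lemma cbin2_tendsto_0: "cbin2 \<longlonglongrightarrow> 0"
proof -
  have "(\<lambda>n. inverse (real n) * (real n * cbin2 n)) \<longlonglongrightarrow> 0 * (1 / pi)"
    by (intro tendsto_intros n_cbin2_tendsto lim_inverse_n)
  moreover have "eventually (\<lambda>n. inverse (real n) * (real n * cbin2 n) = cbin2 n) sequentially"
    using eventually_gt_at_top[of 0] by eventually_elim simp
  ultimately show ?thesis
    by (simp add: filterlim_cong)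
qed

lemma summable_cbin2:
  assumes "\<bar>x\<bar> < 1"
  shows "summable (\<lambda>n. cbin2 n * x ^ n)"
proof (rule summable_comparison_test')
  show "summable (\<lambda>n. \<bar>x\<bar> ^ n)"
    using assms by (simp add: summable_geometric)
  show "norm (cbin2 n * x ^ n) \<le> \<bar>x\<bar> ^ n" for n
    using mult_right_mono[OF cbin2_le_1[of n], of "\<bar>x\<bar> ^ n"] cbin2_pos[of n]
    by (simp add: abs_mult power_abs)
qed

lemma ell_0 [simp]: "ell 0 = 1"
  unfolding ell_def using powser_zero[of cbin2] by simp

lemma ell_flux_0 [simp]: "ell_flux 0 = 0"
  by (simp add: ell_flux_def)

lemma ell_ge_1:
  assumes "0 \<le> x" "x < 1"
  shows "1 \<le> ell x"
proof -
  have "(\<Sum>n\<in>{0}. cbin2 n * x ^ n) \<le> ell x"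
    unfolding ell_def using assms less_imp_le[OF cbin2_pos]
    by (intro sum_le_suminf summable_cbin2) auto
  then show ?thesis by simp
qed

text \<open>Multiplying the derivative of \<^const>\<open>ell\<close> by x (1 - x) produces these coefficients.\<close>
definition flux_coeff :: "nat \<Rightarrow> real" where
  "flux_coeff n = real n * cbin2 n - real (n - 1) * cbin2 (n - 1)"

lemma flux_coeff_0 [simp]: "flux_coeff 0 = 0"
  by (simp add: flux_coeff_def)

text \<open>After \<open>cbin2_Suc\<close> this is (n + 1/2)^2 - n (n + 1) = 1/4: the self-adjoint
  hypergeometric equation, read off coefficient by coefficient.\<close>

lemma flux_coeff_Suc: "flux_coeff (Suc n) = cbin2 n / (4 * real (Suc n))"
proof -
  have "real (Suc n) * flux_coeff (Suc n) = (real n + 1)^2 * cbin2 (Suc n) - real n * (real n + 1) * cbin2 n"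
    by (simp add: flux_coeff_def power2_eq_square algebra_simps)
  also have "\<dots> = cbin2 n / 4"
    unfolding cbin2_Suc by (simp add: power2_eq_square algebra_simps)
  finally have "flux_coeff (Suc n) * real (Suc n) = cbin2 n / 4"
    by (simp only: mult.commute)
  then have "flux_coeff (Suc n) = cbin2 n / 4 / real (Suc n)"
    by (intro nonzero_eq_divide_eq[THEN iffD2]) (simp_all only: of_nat_eq_0_iff nat.distinct not_False_eq_True)
  then show ?thesis
    by (simp only: divide_divide_eq_left)
qed

lemma flux_coeff_nonneg: "0 \<le> flux_coeff n"
  by (cases n) (simp_all add: flux_coeff_Suc less_imp_le[OF cbin2_pos])

lemma flux_coeff_le_1: "flux_coeff n \<le> 1"
proof (cases n)
  case (Suc m)
  have "cbin2 m \<le> 4 * real (Suc m)"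
    using cbin2_le_1[of m] by simp
  then show ?thesis
    unfolding Suc flux_coeff_Suc by (simp add: divide_simps)
qed simp

text \<open>The sum telescopes: the first N terms after index 0 add up to
  \<open>real N * cbin2 N\<close>.\<close>

lemma flux_coeff_sums: "flux_coeff sums (1 / pi)"
proof -
  have "(\<Sum>n<N. flux_coeff (Suc n)) = real N * cbin2 N" for N
    by (induction N) (simp_all add: flux_coeff_def)
  then have "(\<lambda>n. flux_coeff (Suc n)) sums (1 / pi)"
    using n_cbin2_tendsto by (simp add: sums_def)
  then show ?thesis
    by (subst (asm) sums_Suc_iff) simp
qed

section \<open>The two series and their derivatives for |x| < 1\<close>

lemma summable_flux_coeff:
  assumes "\<bar>x\<bar> < 1"
  shows "summable (\<lambda>n. flux_coeff n * x ^ n)"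
proof (rule summable_comparison_test')
  show "summable (\<lambda>n. \<bar>x\<bar> ^ n)"
    using assms by (simp add: summable_geometric)
  show "norm (flux_coeff n * x ^ n) \<le> \<bar>x\<bar> ^ n" for n
    using mult_right_mono[OF flux_coeff_le_1[of n], of "\<bar>x\<bar> ^ n"] flux_coeff_nonneg[of n]
    by (simp add: abs_mult power_abs)
qed

lemma ell_flux_eq:
  assumes "\<bar>x\<bar> < 1"
  shows "ell_flux x = (\<Sum>n. flux_coeff n * x ^ n)"
  using suminf_split_head[OF summable_flux_coeff[OF assms]]
  by (simp add: ell_flux_def flux_coeff_Suc)

lemma ell_flux_has_derivative [derivative_intros]:
  assumes "\<bar>x\<bar> < 1"
  shows "(ell_flux has_real_derivative ell x / 4) (at x)"
proof -
  obtain y where y: "\<bar>x\<bar> < y" "y < 1"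
    using dense[OF assms] by blast
  have "((\<lambda>x. \<Sum>n. flux_coeff n * x ^ n) has_real_derivative (\<Sum>n. diffs flux_coeff n * x ^ n)) (at x)"
    using y by (intro termdiffs_strong[of _ y] summable_flux_coeff) auto
  moreover have "diffs flux_coeff n = cbin2 n / 4" for n
    by (simp add: diffs_def flux_coeff_Suc del: of_nat_Suc)
  then have "(\<Sum>n. diffs flux_coeff n * x ^ n) = (\<Sum>n. cbin2 n * x ^ n / 4)"
    by (simp only: times_divide_eq_left)
  moreover have "\<dots> = ell x / 4"
    unfolding ell_def by (rule suminf_divide[OF summable_cbin2[OF assms]])
  ultimately have deriv: "((\<lambda>x. \<Sum>n. flux_coeff n * x ^ n) has_real_derivative ell x / 4) (at x)"
    by simp
  have ev: "eventually (\<lambda>z. ell_flux z = (\<Sum>n. flux_coeff n * z ^ n)) (nhds x)"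
    using assms by (intro eventually_nhds_in_open[of "{-1<..<1}", THEN eventually_mono] ell_flux_eq) auto
  show ?thesis
    using deriv by (simp only: DERIV_cong_ev[OF refl ev refl])
qed

definition ell_deriv :: "real \<Rightarrow> real" where
  "ell_deriv x = (\<Sum>n. diffs cbin2 n * x ^ n)"

lemma ell_has_derivative:
  assumes "\<bar>x\<bar> < 1"
  shows "(ell has_real_derivative ell_deriv x) (at x)"
proof -
  obtain y where y: "\<bar>x\<bar> < y" "y < 1"
    using dense[OF assms] by blast
  then show ?thesis
    unfolding ell_def[abs_def] ell_deriv_def
    by (intro termdiffs_strong[of _ y] summable_cbin2) auto
qed

text \<open>The series of x ell' has coefficients n c(n) with c = \<open>cbin2\<close>, that of x^2
  ell' the same ones shifted by one place; their difference is \<open>flux_coeff\<close>.\<close>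

lemma ell_flux_eq_deriv:
  assumes "\<bar>x\<bar> < 1"
  shows "ell_flux x = x * (1 - x) * ell_deriv x"
proof -
  have s: "summable (\<lambda>n. diffs cbin2 n * x ^ n)"
    using dense[OF assms] assms
    by (auto intro!: termdiff_converges[of x 1] summable_cbin2)
  have "(\<lambda>n. real (Suc n) * cbin2 (Suc n) * x ^ Suc n) sums (x * ell_deriv x)"
    using sums_mult[OF summable_sums[OF s], of x] by (simp add: ell_deriv_def diffs_def algebra_simps)
  then have a: "(\<lambda>n. real n * cbin2 n * x ^ n) sums (x * ell_deriv x)"
    by (subst (asm) sums_Suc_iff) simp
  have "(\<lambda>n. real n * cbin2 n * x ^ Suc n) sums (x * (x * ell_deriv x))"
    using sums_mult[OF a, of x] by (simp add: algebra_simps)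
  \<comment> \<open>Truncated subtraction makes the term at n = 0 equal to 0 *
    \<open>cbin2 0\<close> = 0, so the shift adds no head term.\<close>
  then have "(\<lambda>n. real (n - 1) * cbin2 (n - 1) * x ^ n) sums (x * (x * ell_deriv x))"
    using sums_Suc_iff[of "\<lambda>n. real (n - 1) * cbin2 (n - 1) * x ^ n"] by simp
  from sums_diff[OF a this] have "(\<lambda>n. flux_coeff n * x ^ n) sums (x * (1 - x) * ell_deriv x)"
    by (simp add: flux_coeff_def algebra_simps)
  then show ?thesis
    using ell_flux_eq[OF assms] by (simp add: sums_iff)
qed

text \<open>For nonnegative coefficients the series at 1 itself dominates on [0, 1], so the M-test
  gives uniform convergence and hence continuity up to 1.\<close>

lemma abel_limit:
  fixes a :: "nat \<Rightarrow> real"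
  assumes "a sums s" "\<And>n. 0 \<le> a n"
  shows "((\<lambda>x. \<Sum>n. a n * x ^ n) \<longlongrightarrow> s) (at_left 1)"
proof -
  have "uniform_limit {0..1} (\<lambda>n x. \<Sum>i<n. a i * x ^ i) (\<lambda>x. \<Sum>i. a i * x ^ i) sequentially"
    using assms
    by (intro Weierstrass_m_test[of _ _ a])
      (auto simp: sums_iff abs_mult intro!: mult_left_le power_le_one)
  then have "continuous_on {0..1} (\<lambda>x. \<Sum>i. a i * x ^ i)"
    by (rule uniform_limit_theorem[rotated]) (auto intro!: always_eventually continuous_intros)
  then have "((\<lambda>x. \<Sum>i. a i * x ^ i) \<longlongrightarrow> (\<Sum>i. a i * 1 ^ i)) (at 1 within {0..1})"
    unfolding continuous_on_def by (rule bspec) simp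
  moreover have "(\<Sum>i. a i * 1 ^ i) = s"
    using assms by (simp add: sums_iff)
  ultimately show ?thesis
    by (simp add: at_within_Icc_at_left)
qed

lemma ell_flux_at_left_1: "(ell_flux \<longlongrightarrow> 1 / pi) (at_left 1)"
proof -
  have "eventually (\<lambda>x::real. x \<in> {0<..<1}) (at_left 1)"
    by (rule eventually_at_leftI[of 0]) auto
  then have "eventually (\<lambda>x. ell_flux x = (\<Sum>n. flux_coeff n * x ^ n)) (at_left 1)"
    by eventually_elim (simp add: ell_flux_eq)
  then show ?thesis
    using abel_limit[OF flux_coeff_sums flux_coeff_nonneg] by (simp add: filterlim_cong)
qed

text \<open>Summation by parts turns the product into 1 - x (sum of (c(n) - c(n+1)) x^n) with c =
  \<open>cbin2\<close>; these nonnegative differences telescope to 1, so \<open>abel_limit\<close>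
  applies. The bound controls the growth of \<open>ell\<close> at 1 in Legendre's relation.\<close>

lemma ell_at_left_1: "((\<lambda>x. (1 - x) * ell x) \<longlongrightarrow> 0) (at_left 1)"
proof -
  have "(\<lambda>n. - (cbin2 (Suc n) - cbin2 n)) sums - (0 - cbin2 0)"
    by (intro sums_minus telescope_sums cbin2_tendsto_0)
  then have lim: "((\<lambda>x. 1 - x * (\<Sum>n. (cbin2 n - cbin2 (Suc n)) * x ^ n)) \<longlongrightarrow> 1 - 1 * 1) (at_left 1)"
    by (intro tendsto_intros abel_limit) (simp_all add: cbin2_Suc_le)
  have eq: "(1 - x) * ell x = 1 - x * (\<Sum>n. (cbin2 n - cbin2 (Suc n)) * x ^ n)" if "0 < x" "x < 1" for x
  proof -
    have x: "\<bar>x\<bar> < 1" using that by simp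
    have a: "(\<lambda>n. cbin2 n * x ^ n) sums ell x"
      unfolding ell_def using summable_cbin2[OF x] by (rule summable_sums)
    then have "(\<lambda>n. cbin2 (Suc n) * x ^ Suc n) sums (ell x - 1)"
      by (subst sums_Suc_iff) simp
    from sums_diff[OF sums_mult[OF a, of x] this]
    have "(\<lambda>n. x * ((cbin2 n - cbin2 (Suc n)) * x ^ n)) sums (x * ell x - (ell x - 1))"
      by (simp add: algebra_simps)
    from sums_mult[OF this, of "inverse x"] that
    have "(\<lambda>n. (cbin2 n - cbin2 (Suc n)) * x ^ n) sums (inverse x * (x * ell x - (ell x - 1)))"
      by (simp add: mult.assoc[symmetric])
    then show ?thesis
      using that by (simp add: sums_iff field_simps)
  qed
  have "eventually (\<lambda>x::real. x \<in> {0<..<1}) (at_left 1)"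
    by (rule eventually_at_leftI[of 0]) auto
  then have "eventually (\<lambda>x. (1 - x) * ell x = 1 - x * (\<Sum>n. (cbin2 n - cbin2 (Suc n)) * x ^ n)) (at_left 1)"
    by eventually_elim (simp add: eq)
  then show ?thesis
    using lim by (simp add: filterlim_cong)
qed

subsection \<open>The squared binomial polynomials\<close>

text \<open>Homogeneous form of the Legendre polynomial: for U different from V it is (U - V)^N
  P_N((U + V) / (U - V)), see \<open>legendre_eq_csq\<close>.\<close>

definition csq :: "nat \<Rightarrow> real \<Rightarrow> real \<Rightarrow> real" where
  "csq N U V = (\<Sum>m\<le>N. (real (N choose m))^2 * U ^ m * V ^ (N - m))"

lemma csq_0_left [simp]: "csq N 0 V = V ^ N"
proof -
  have "csq N 0 V = (\<Sum>m\<in>{0}. (real (N choose m))^2 * 0 ^ m * V ^ (N - m))"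
    unfolding csq_def by (intro sum.mono_neutral_right) auto
  then show ?thesis by simp
qed

lemma csq_scale: "csq N (t * U) (t * V) = t ^ N * csq N U V"
proof -
  have "(t * U) ^ m * (t * V) ^ (N - m) = t ^ N * (U ^ m * V ^ (N - m))" if "m \<le> N" for m
    using power_add[of t m "N - m"] that by (simp add: power_mult_distrib ac_simps)
  then show ?thesis
    by (simp add: csq_def sum_distrib_left mult.assoc mult.left_commute[of "t ^ N"])
qed

lemma csq_nonneg: "0 \<le> U \<Longrightarrow> 0 \<le> V \<Longrightarrow> 0 \<le> csq N U V"
  by (simp add: csq_def sum_nonneg)

lemma sum_power2_le_power2_sum:
  fixes f :: "'a \<Rightarrow> real"
  assumes "finite A" "\<And>x. x \<in> A \<Longrightarrow> 0 \<le> f x"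
  shows "(\<Sum>x\<in>A. (f x)^2) \<le> (\<Sum>x\<in>A. f x)^2"
  using assms
proof (induction A rule: finite_induct)
  case (insert x A)
  have "0 \<le> f x * sum f A"
    using insert.prems by (intro mult_nonneg_nonneg sum_nonneg) auto
  then show ?case
    using insert by (simp add: power2_sum)
qed simp

text \<open>A sum of squares of nonnegative numbers is at most the square of their sum, and the
  latter is a binomial expansion in sqrt U and sqrt V.\<close>

lemma csq_le:
  assumes "0 \<le> U" "0 \<le> V"
  shows "csq N U V \<le> ((sqrt U + sqrt V)^2) ^ N"
proof -
  have "csq N U V = (\<Sum>m\<le>N. (real (N choose m) * sqrt U ^ m * sqrt V ^ (N - m))^2)"
    using assms by (simp add: csq_def power_mult_distrib power_mult[symmetric] mult.commute[of _ 2])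
      (simp add: power_mult)
  also have "\<dots> \<le> (\<Sum>m\<le>N. real (N choose m) * sqrt U ^ m * sqrt V ^ (N - m))^2"
    using assms by (intro sum_power2_le_power2_sum) auto
  also have "\<dots> = ((sqrt U + sqrt V)^2) ^ N"
    unfolding binomial_ring[of _ _ N, symmetric] by (simp only: power_mult[symmetric] mult.commute)
  finally show ?thesis .
qed

text \<open>The left side is (d/dU) U (d/dU) applied to \<open>csq (Suc M) U V\<close>; absorption
  of m into the binomial lowers the degree. The next lemma is the mirror image in V.\<close>

lemma csq_diff_left:
  "(\<Sum>m\<le>Suc M. (real (Suc M choose m))^2 * (real m)^2 * U ^ (m - 1) * V ^ (Suc M - m))
    = (real M + 1)^2 * csq M U V"
proof -
  have "real (Suc M choose Suc m) * real (Suc m) = (real M + 1) * real (M choose m)" for m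
    using arg_cong[OF Suc_times_binomial[of m M], of real] by (simp only: of_nat_mult of_nat_Suc) (simp add: ac_simps)
  then have "(real (Suc M choose Suc m))^2 * (real (Suc m))^2 = (real M + 1)^2 * (real (M choose m))^2" for m
    by (simp only: power_mult_distrib[symmetric])
  then show ?thesis
    by (simp only: sum.atMost_Suc_shift csq_def sum_distrib_left) (simp add: mult.assoc)
qed

lemma csq_diff_right:
  "(\<Sum>m\<le>Suc M. (real (Suc M choose m))^2 * (real (Suc M - m))^2 * U ^ m * V ^ (Suc M - m - 1))
    = (real M + 1)^2 * csq M U V"
proof -
  have "real (Suc M choose m) * real (Suc M - m) = (real M + 1) * real (M choose m)" for m
    using arg_cong[OF binomial_absorb_comp[of "Suc M" m], of real] by (simp only: of_nat_mult) (simp add: ac_simps)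
  then have "(real (Suc M choose m))^2 * (real (Suc M - m))^2 = (real M + 1)^2 * (real (M choose m))^2" for m
    by (simp only: power_mult_distrib[symmetric])
  then show ?thesis
    by (simp only: sum.atMost_Suc csq_def sum_distrib_left) (simp add: mult.assoc)
qed

text \<open>With U = X (1 - Y) and V = Y (1 - X) one has (1 - U - V)^2 - 4 U V = (1 - X - Y)^2 > 0.
  Together with \<open>csq_le\<close> this gives geometric convergence in Brafman's formula.\<close>

lemma sqrt_sum_less_1:
  assumes "0 \<le> X" "0 \<le> Y" "X + Y < 1"
  shows "(sqrt (X * (1 - Y)) + sqrt (Y * (1 - X)))^2 < 1"
proof -
  let ?U = "X * (1 - Y)" and ?V = "Y * (1 - X)"
  have nn: "0 \<le> ?U" "0 \<le> ?V" using assms by auto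
  have "0 < (1 - X - Y)^2" using assms by simp
  also have "\<dots> = (1 - ?U - ?V)^2 - 4 * (?U * ?V)"
    by (simp add: power2_eq_square algebra_simps)
  finally have "(2 * sqrt (?U * ?V))^2 < (1 - ?U - ?V)^2"
    using nn by (simp add: power_mult_distrib)
  moreover have "0 \<le> 1 - ?U - ?V"
    using assms(3) mult_nonneg_nonneg[OF assms(1,2)] by (simp add: algebra_simps)
  ultimately have "2 * sqrt (?U * ?V) < 1 - ?U - ?V"
    by (rule power_less_imp_less_base)
  moreover have "(sqrt ?U + sqrt ?V)^2 = ?U + ?V + 2 * sqrt (?U * ?V)"
    by (simp only: power2_sum real_sqrt_mult[of ?U ?V] real_sqrt_pow2[OF nn(1)] real_sqrt_pow2[OF nn(2)] mult.assoc[of 2])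
  ultimately show ?thesis
    by linarith
qed

section \<open>The differential equation of the polynomials and the Wronskian of the partial
  sums\<close>

definition csq_deriv :: "nat \<Rightarrow> real \<Rightarrow> real \<Rightarrow> real" where
  "csq_deriv N Y X = (\<Sum>m\<le>N. (real (N choose m))^2 *
     (real m * (1 - Y) * (X * (1 - Y)) ^ (m - 1) * (Y * (1 - X)) ^ (N - m)
      - real (N - m) * Y * (X * (1 - Y)) ^ m * (Y * (1 - X)) ^ (N - m - 1)))"

text \<open>The analogue of \<open>ell_flux\<close>, namely X (1 - X) d/dX of the polynomial for
  fixed Y. On U^m V^(N - m) this operator is multiplication by m (1 - X) - (N - m) X = m - N X, so
  no power is lowered.\<close>

definition csq_flux :: "nat \<Rightarrow> real \<Rightarrow> real \<Rightarrow> real" where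
  "csq_flux N Y X = (\<Sum>m\<le>N. (real (N choose m))^2 *
     ((real m - real N * X) * (X * (1 - Y)) ^ m * (Y * (1 - X)) ^ (N - m)))"

lemma csq_has_derivative:
  "((\<lambda>X. csq N (X * (1 - Y)) (Y * (1 - X))) has_real_derivative csq_deriv N Y X) (at X)"
  unfolding csq_def csq_deriv_def
  by (rule DERIV_sum) (auto intro!: derivative_eq_intros simp: algebra_simps)

lemma mult_power_pred: "real m * (u * u ^ (m - 1)) = real m * u ^ m"
  by (cases m) simp_all

lemma csq_flux_eq: "csq_flux N Y X = X * (1 - X) * csq_deriv N Y X"
  unfolding csq_flux_def csq_deriv_def sum_distrib_left
proof (rule sum.cong)
  fix m assume m: "m \<in> {..N}"
  define U V where "U = X * (1 - Y)" and "V = Y * (1 - X)"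
  define n where "n = N - m"
  have N: "real N = real m + real n"
    using m by (simp add: n_def)
  have "X * (1 - X) * (real m * (1 - Y) * U ^ (m - 1) * V ^ n - real n * Y * U ^ m * V ^ (n - 1))
      = (1 - X) * (real m * (U * U ^ (m - 1))) * V ^ n - X * U ^ m * (real n * (V * V ^ (n - 1)))"
    by (simp add: U_def V_def algebra_simps)
  also have "\<dots> = (real m - real N * X) * U ^ m * V ^ n"
    unfolding mult_power_pred N by (simp add: algebra_simps)
  finally show "(real (N choose m))^2 * ((real m - real N * X) * (X * (1 - Y)) ^ m * (Y * (1 - X)) ^ (N - m))
      = X * (1 - X) * ((real (N choose m))^2 *
     (real m * (1 - Y) * (X * (1 - Y)) ^ (m - 1) * (Y * (1 - X)) ^ (N - m)
      - real (N - m) * Y * (X * (1 - Y)) ^ m * (Y * (1 - X)) ^ (N - m - 1)))"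
    by (simp add: U_def V_def n_def mult.left_commute)
qed simp

lemma csq_flux_0 [simp]: "csq_flux 0 Y X = 0"
  by (simp add: csq_flux_def)

lemma csq_flux_at_0 [simp]: "csq_flux N Y 0 = 0"
  by (simp add: csq_flux_eq)

text \<open>The terms with lowered powers are those of \<open>csq_diff_left\<close> and
  \<open>csq_diff_right\<close>, with weights 1 - Y and Y that add up to 1; all other terms are
  multiples of the polynomial itself.\<close>

lemma csq_flux_has_derivative:
  "(csq_flux (Suc M) Y has_real_derivative
     (real M + 1)^2 * csq M (X * (1 - Y)) (Y * (1 - X))
     - (real M + 1) * (real M + 2) * csq (Suc M) (X * (1 - Y)) (Y * (1 - X))) (at X)"
proof -
  define U V where "U = X * (1 - Y)" and "V = Y * (1 - X)"
  let ?N = "Suc M"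
  let ?D = "\<lambda>m. - real ?N * U ^ m * V ^ (?N - m) + (real m - real ?N * X) *
     (real m * (1 - Y) * U ^ (m - 1) * V ^ (?N - m) - real (?N - m) * Y * U ^ m * V ^ (?N - m - 1))"
  have "(csq_flux ?N Y has_real_derivative (\<Sum>m\<le>?N. (real (?N choose m))^2 * ?D m)) (at X)"
    unfolding csq_flux_def[abs_def]
    by (rule DERIV_sum, rule DERIV_cmult) (auto intro!: derivative_eq_intros simp: U_def V_def algebra_simps)
  also have "(\<Sum>m\<le>?N. (real (?N choose m))^2 * ?D m) =
     (\<Sum>m\<le>?N. (1 - Y) * ((real (?N choose m))^2 * (real m)^2 * U ^ (m - 1) * V ^ (?N - m))
       + Y * ((real (?N choose m))^2 * (real (?N - m))^2 * U ^ m * V ^ (?N - m - 1))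
       - (real M + 1) * (real M + 2) * ((real (?N choose m))^2 * U ^ m * V ^ (?N - m)))"
  proof (rule sum.cong)
    fix m assume m: "m \<in> {..?N}"
    define n where "n = ?N - m"
    define c where "c = (real (?N choose m))^2"
    have N: "real M = real m + real n - 1"
      using m by (auto simp: n_def of_nat_diff)
    \<comment> \<open>Only X (1 - Y) = U and X Y = Y - V are used. The products
      \<open>U * U ^ (m - 1)\<close> and \<open>V * V ^ (n - 1)\<close> stay intact so that
      \<open>mult_power_pred\<close> also covers m = 0 and n = 0.\<close>
    have "c * (- (real m + real n) * U ^ m * V ^ n + (real m - (real m + real n) * X) *
       (real m * (1 - Y) * U ^ (m - 1) * V ^ n - real n * Y * U ^ m * V ^ (n - 1)))
     = c * (- (real m + real n) * U ^ m * V ^ n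
       + (real m)^2 * (1 - Y) * U ^ (m - 1) * V ^ n + (real n)^2 * Y * U ^ m * V ^ (n - 1)
       - (real m + real n) * (real m * (U * U ^ (m - 1))) * V ^ n
       - (real m + real n) * U ^ m * (real n * (V * V ^ (n - 1))))"
      by (simp add: U_def[symmetric] V_def[symmetric]) (simp add: U_def V_def power2_eq_square algebra_simps)
    then show "c * ?D m =
       (1 - Y) * (c * (real m)^2 * U ^ (m - 1) * V ^ (?N - m))
       + Y * (c * (real (?N - m))^2 * U ^ m * V ^ (?N - m - 1))
       - (real M + 1) * (real M + 2) * (c * U ^ m * V ^ (?N - m))"
      unfolding n_def[symmetric] mult_power_pred by (simp add: N algebra_simps)
  qed simp
  also have "\<dots> = (1 - Y) * ((real M + 1)^2 * csq M U V) + Y * ((real M + 1)^2 * csq M U V)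
      - (real M + 1) * (real M + 2) * csq ?N U V"
    unfolding sum_subtractf sum.distrib sum_distrib_left[symmetric] csq_diff_left csq_diff_right
    by (simp only: csq_def)
  also have "\<dots> = (real M + 1)^2 * csq M U V - (real M + 1) * (real M + 2) * csq ?N U V"
    by (simp add: algebra_simps)
  finally show ?thesis
    by (simp add: U_def V_def)
qed

text \<open>For N < M the polynomial of degree N receives (N + 1)^2 c(N+1) - N (N + 1) c(N) = c(N) /
  4 with c = \<open>cbin2\<close>. The top degree lacks the first contribution, which leaves the
  remainder.\<close>

lemma sum_csq_flux_has_derivative:
  "((\<lambda>X. \<Sum>N\<le>M. cbin2 N * csq_flux N Y X) has_real_derivative
     (\<Sum>N\<le>M. cbin2 N * csq N (X * (1 - Y)) (Y * (1 - X))) / 4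
     - (real M + 1/2)^2 * cbin2 M * csq M (X * (1 - Y)) (Y * (1 - X))) (at X)"
proof (induction M)
  case 0
  show ?case by (simp add: csq_def power2_eq_square)
next
  case (Suc M)
  let ?q = "\<lambda>N. csq N (X * (1 - Y)) (Y * (1 - X))"
  have eq: "((\<Sum>N\<le>M. cbin2 N * ?q N) / 4 - (real M + 1/2)^2 * cbin2 M * ?q M)
      + cbin2 (Suc M) * ((real M + 1)^2 * ?q M - (real M + 1) * (real M + 2) * ?q (Suc M))
     = (\<Sum>N\<le>Suc M. cbin2 N * ?q N) / 4 - (real (Suc M) + 1/2)^2 * cbin2 (Suc M) * ?q (Suc M)"
    unfolding cbin2_Suc[of M, symmetric] by (simp add: power2_eq_square field_simps)
  have "((\<lambda>X. (\<Sum>N\<le>M. cbin2 N * csq_flux N Y X) + cbin2 (Suc M) * csq_flux (Suc M) Y X) has_real_derivative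
     ((\<Sum>N\<le>M. cbin2 N * ?q N) / 4 - (real M + 1/2)^2 * cbin2 M * ?q M)
      + cbin2 (Suc M) * ((real M + 1)^2 * ?q M - (real M + 1) * (real M + 2) * ?q (Suc M))) (at X)"
    by (intro DERIV_add DERIV_cmult Suc.IH csq_flux_has_derivative)
  then show ?case
    by (simp only: eq sum.atMost_Suc)
qed

text \<open>Both functions satisfy (X (1 - X) y')' = y / 4, the partial sum up to its remainder. In
  the derivative of the Wronskian everything but the remainder times \<open>ell\<close>
  cancels.\<close>

lemma wronskian_has_derivative:
  assumes "\<bar>X\<bar> < 1"
  shows "((\<lambda>X. (\<Sum>N\<le>M. cbin2 N * csq_flux N Y X) * ell X
      - (\<Sum>N\<le>M. cbin2 N * csq N (X * (1 - Y)) (Y * (1 - X))) * ell_flux X) has_real_derivative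
     - ((real M + 1/2)^2 * cbin2 M * csq M (X * (1 - Y)) (Y * (1 - X)) * ell X)) (at X)"
proof -
  define D where "D X = (\<Sum>N\<le>M. cbin2 N * csq_deriv N Y X)" for X
  have dG: "((\<lambda>X. \<Sum>N\<le>M. cbin2 N * csq N (X * (1 - Y)) (Y * (1 - X))) has_real_derivative D X) (at X)"
    unfolding D_def by (intro DERIV_sum DERIV_cmult csq_has_derivative)
  have H: "(\<Sum>N\<le>M. cbin2 N * csq_flux N Y X) = X * (1 - X) * D X"
    by (simp add: D_def csq_flux_eq sum_distrib_left mult.left_commute)
  show ?thesis
    by (rule derivative_eq_intros sum_csq_flux_has_derivative dG ell_has_derivative
          ell_flux_has_derivative assms refl)+
      (simp add: H ell_flux_eq_deriv[OF assms] algebra_simps)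
qed

subsection \<open>Brafman's formula\<close>

text \<open>The continuous bound from \<open>csq_le\<close> attains its maximum on the compact
  interval, and it is below 1 at every point.\<close>

lemma csq_uniform_bound:
  assumes "0 \<le> x" "0 \<le> Y" "x + Y < 1"
  shows "\<exists>r. 0 \<le> r \<and> r < 1 \<and> (\<forall>X\<in>{0..x}. \<forall>N. csq N (X * (1 - Y)) (Y * (1 - X)) \<le> r ^ N)"
proof -
  let ?s = "\<lambda>X. (sqrt (X * (1 - Y)) + sqrt (Y * (1 - X)))^2"
  have "continuous_on {0..x} ?s"
    by (intro continuous_intros)
  then obtain X0 where X0: "X0 \<in> {0..x}" "\<And>X. X \<in> {0..x} \<Longrightarrow> ?s X \<le> ?s X0"
    using continuous_attains_sup[of "{0..x}" ?s] assms by auto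
  show ?thesis
  proof (intro exI conjI ballI allI)
    show "0 \<le> ?s X0" by simp
    show "?s X0 < 1"
      using X0(1) assms by (intro sqrt_sum_less_1) auto
    fix X N assume X: "X \<in> {0..x}"
    then have "csq N (X * (1 - Y)) (Y * (1 - X)) \<le> ?s X ^ N"
      using assms by (intro csq_le) auto
    also have "\<dots> \<le> ?s X0 ^ N"
      by (intro power_mono[OF X0(2)[OF X]]) auto
    finally show "csq N (X * (1 - Y)) (Y * (1 - X)) \<le> ?s X0 ^ N" .
  qed
qed

lemma ell_mono:
  assumes "0 \<le> x" "x \<le> y" "y < 1"
  shows "ell x \<le> ell y"
  unfolding ell_def using assms
  by (intro suminf_le summable_cbin2 mult_left_mono power_mono less_imp_le[OF cbin2_pos]) auto

text \<open>
  The partial sums satisfy the hypergeometric equation up to a remainder that tends to 0, so their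
  Wronskian with \<^const>\<open>ell\<close> tends to 0 and the quotient becomes constant in the limit.
\<close>
theorem brafman:
  assumes "0 \<le> x" "0 \<le> Y" "x + Y < 1"
  shows "(\<lambda>N. cbin2 N * csq N (x * (1 - Y)) (Y * (1 - x))) sums (ell x * ell Y)"
proof (cases "x = 0")
  case True
  have "(\<lambda>N. cbin2 N * Y ^ N) sums ell Y"
    unfolding ell_def using assms True by (intro summable_sums summable_cbin2) auto
  then show ?thesis by (simp add: True)
next
  case False
  with assms have x: "0 < x" "x < 1" by auto
  obtain r where r: "0 \<le> r" "r < 1"
    and r_bound: "\<forall>X\<in>{0..x}. \<forall>N. csq N (X * (1 - Y)) (Y * (1 - X)) \<le> r ^ N"
    using csq_uniform_bound[OF assms] by blast
  define G where "G M X = (\<Sum>N\<le>M. cbin2 N * csq N (X * (1 - Y)) (Y * (1 - X)))" for M X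
  define H where "H M X = (\<Sum>N\<le>M. cbin2 N * csq_flux N Y X)" for M X
  define D where "D M X = (\<Sum>N\<le>M. cbin2 N * csq_deriv N Y X)" for M X
  define W where "W M X = H M X * ell X - G M X * ell_flux X" for M X
  \<comment> \<open>Bounds |W'| on [0, x], from \<open>cbin2_le_1\<close>, the bound r ^ M and
    monotonicity of \<open>ell\<close>.\<close>
  define \<epsilon> where "\<epsilon> M = (real M + 1/2)^2 * r ^ M * ell x" for M
  have dW: "(W M has_real_derivative
     - ((real M + 1/2)^2 * cbin2 M * csq M (X * (1 - Y)) (Y * (1 - X)) * ell X)) (at X)" if "\<bar>X\<bar> < 1" for M X
    using wronskian_has_derivative[OF that] by (simp add: W_def[abs_def] H_def G_def)
  have dG: "(G M has_real_derivative D M X) (at X)" for M X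
    unfolding D_def G_def[abs_def] by (intro DERIV_sum DERIV_cmult csq_has_derivative)
  have H: "H M X = X * (1 - X) * D M X" for M X
    by (simp add: D_def H_def csq_flux_eq sum_distrib_left mult.left_commute)
  have W_le: "\<bar>W M X\<bar> \<le> \<epsilon> M * X" if "0 \<le> X" "X \<le> x" for M X
  proof -
    have "norm (W M X - W M 0) \<le> \<epsilon> M * norm (X - 0)"
    proof (rule field_differentiable_bound)
      show "convex {0..x}" "X \<in> {0..x}" "0 \<in> {0..x}"
        using that by auto
      fix z assume z: "z \<in> {0..x}"
      show "(W M has_field_derivative
         - ((real M + 1/2)^2 * cbin2 M * csq M (z * (1 - Y)) (Y * (1 - z)) * ell z)) (at z within {0..x})"
        using z x by (intro has_field_derivative_at_within[OF dW]) auto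
      define T where "T = csq M (z * (1 - Y)) (Y * (1 - z))"
      have T: "0 \<le> T" "T \<le> r ^ M"
        using z x assms r_bound by (auto simp: T_def intro!: csq_nonneg)
      have e: "0 \<le> ell z" "ell z \<le> ell x"
        using z x ell_ge_1[of z] by (auto intro!: ell_mono)
      have c: "0 \<le> cbin2 M" "cbin2 M \<le> 1"
        by (simp_all add: cbin2_le_1 less_imp_le[OF cbin2_pos])
      have "\<bar>(real M + 1/2)^2 * cbin2 M * T * ell z\<bar> = (real M + 1/2)^2 * cbin2 M * T * ell z"
        using T(1) e(1) c(1) by simp
      also have "\<dots> \<le> (real M + 1/2)^2 * 1 * r ^ M * ell x"
        using T e c r(1) by (intro mult_mono mult_nonneg_nonneg zero_le_power) simp_all
      finally show "norm (- ((real M + 1/2)^2 * cbin2 M * csq M (z * (1 - Y)) (Y * (1 - z)) * ell z)) \<le> \<epsilon> M"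
        by (simp add: \<epsilon>_def T_def)
    qed
    moreover have "W M 0 = 0"
      by (simp add: W_def H_def)
    ultimately show ?thesis
      using that by simp
  qed
  \<comment> \<open>The derivative of G / ell at z is W / (z (1 - z) ell^2). The bound on W carries
    a factor z, which cancels the singularity at 0.\<close>
  have quot: "\<bar>G M x / ell x - G M 0\<bar> \<le> x * (\<epsilon> M / (1 - x))" for M
  proof -
    have d: "((\<lambda>X. G M X / ell X) has_real_derivative (D M X * ell X - G M X * ell_deriv X) / (ell X * ell X)) (at X)"
      if "0 \<le> X" "X \<le> x" for X
      using that x ell_ge_1[of X] by (intro DERIV_divide dG ell_has_derivative) auto
    have "continuous_on {0..x} (\<lambda>X. G M X / ell X)"
      using d by (auto intro!: continuous_at_imp_continuous_on DERIV_isCont)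
    moreover have "(\<lambda>X. G M X / ell X) differentiable (at X)" if "0 < X" "X < x" for X
      using d[of X] that by (auto simp: real_differentiable_def)
    ultimately obtain l z where z: "0 < z" "z < x"
        "((\<lambda>X. G M X / ell X) has_real_derivative l) (at z)"
        "G M x / ell x - G M 0 / ell 0 = (x - 0) * l"
      using MVT[of 0 x "\<lambda>X. G M X / ell X"] x by auto
    have l: "l = (D M z * ell z - G M z * ell_deriv z) / (ell z * ell z)"
      using DERIV_unique[OF z(3) d[of z]] z by simp
    have "W M z = z * (1 - z) * (D M z * ell z - G M z * ell_deriv z)"
      using z x by (simp add: W_def H ell_flux_eq_deriv algebra_simps)
    then have "D M z * ell z - G M z * ell_deriv z = W M z / (z * (1 - z))"
      using z x by simp
    then have "\<bar>l\<bar> = \<bar>W M z\<bar> / (z * (1 - z)) / (ell z * ell z)"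
      unfolding l using z x by (simp add: abs_mult)
    also have "\<dots> \<le> \<bar>W M z\<bar> / (z * (1 - z))"
    proof -
      have "1 \<le> ell z * ell z"
        using mult_mono[of 1 "ell z" 1 "ell z"] ell_ge_1[of z] z x by simp
      moreover have "0 \<le> \<bar>W M z\<bar> / (z * (1 - z))"
        using z x by simp
      ultimately show ?thesis
        using divide_left_mono[of 1 "ell z * ell z" "\<bar>W M z\<bar> / (z * (1 - z))"] by simp
    qed
    also have "\<dots> \<le> (\<epsilon> M * z) / (z * (1 - z))"
      using W_le[of z M] z x by (intro divide_right_mono) auto
    also have "\<dots> = \<epsilon> M / (1 - z)"
      using z by simp
    also have "\<dots> \<le> \<epsilon> M / (1 - x)"
      using z x r(1) ell_ge_1[of x] by (intro divide_left_mono) (auto simp: \<epsilon>_def)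
    finally have "x * \<bar>l\<bar> \<le> x * (\<epsilon> M / (1 - x))"
      using x by (intro mult_left_mono) auto
    then show ?thesis
      using z x by (simp add: abs_mult)
  qed
  have "(\<lambda>M. (real M + 1/2)^2 * r ^ M) \<longlonglongrightarrow> 0"
  proof (cases "r = 0")
    case True
    \<comment> \<open>Only from M = 1 on, because 0 ^ 0 = 1.\<close>
    have "eventually (\<lambda>M. (real M + 1/2)^2 * r ^ M = 0) sequentially"
      using eventually_gt_at_top[of 0] by eventually_elim (simp add: True)
    then show ?thesis
      by (rule tendsto_eventually)
  next
    case False
    with r have "0 < r" by simp
    with \<open>r < 1\<close> show ?thesis by real_asymp
  qed
  then have "\<epsilon> \<longlonglongrightarrow> 0 * ell x"
    unfolding \<epsilon>_def[abs_def] by (intro tendsto_intros)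
  then have "(\<lambda>M. x * (\<epsilon> M / (1 - x))) \<longlonglongrightarrow> x * (0 * ell x / (1 - x))"
    using x by (intro tendsto_intros) auto
  then have "(\<lambda>M. x * (\<epsilon> M / (1 - x))) \<longlonglongrightarrow> 0"
    by simp
  then have lim0: "(\<lambda>M. G M x / ell x - G M 0) \<longlonglongrightarrow> 0"
    by (rule Lim_null_comparison[OF always_eventually, rotated]) (simp only: real_norm_def quot simp_thms)
  \<comment> \<open>At X = 0 the polynomials reduce to Y ^ N, which fixes the constant quotient as
    \<open>ell Y\<close>.\<close>
  have "(\<lambda>N. cbin2 N * Y ^ N) sums ell Y"
    unfolding ell_def using assms x by (intro summable_sums summable_cbin2) auto
  then have "(\<lambda>M. G M 0) \<longlonglongrightarrow> ell Y"
    by (simp add: G_def sums_def_le)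
  from tendsto_mult[OF tendsto_add[OF lim0 this] tendsto_const[of "ell x"]]
  have "(\<lambda>M. G M x) \<longlonglongrightarrow> ell Y * ell x"
    using ell_ge_1[of x] x by simp
  then show ?thesis
    by (simp add: sums_def_le G_def mult.commute)
qed

subsection \<open>Legendre polynomials\<close>

text \<open>Choosing nested subsets gives (n choose m) (m choose i) = (n choose i) (n - i choose n -
  m), and Vandermonde's convolution sums the rest. In this form both sides vanish for m < i.\<close>

lemma sum_binomial_sq_binomial:
  assumes "i \<le> n"
  shows "(\<Sum>m\<le>n. (n choose m) * (n choose m) * (m choose i)) = (n choose i) * ((2 * n - i) choose n)"
proof -
  have "(n choose m) * (m choose i) = (n choose i) * ((n - i) choose (n - m))" if "m \<le> n" for m
  proof (cases "i \<le> m")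
    case True
    then have "(n choose m) * (m choose i) = (n choose i) * ((n - i) choose (m - i))"
      using that by (rule choose_mult)
    also have "(n - i) choose (m - i) = (n - i) choose (n - m)"
      using True that binomial_symmetric[of "m - i" "n - i"] by simp
    finally show ?thesis .
  next
    case False
    then have "m < i" "n - i < n - m" using assms that by auto
    then show ?thesis by (simp add: binomial_eq_0)
  qed
  then have "(\<Sum>m\<le>n. (n choose m) * (n choose m) * (m choose i))
      = (\<Sum>m\<le>n. (n choose i) * ((n choose m) * ((n - i) choose (n - m))))"
    by (intro sum.cong) (auto simp: mult.assoc mult.left_commute)
  also have "\<dots> = (n choose i) * ((n + (n - i)) choose n)"
    by (simp add: sum_distrib_left[symmetric] vandermonde)
  finally show ?thesis
    using assms by (simp add: mult_2)
qed

text \<open>Expanding (z + V) ^ m makes the coefficient of z^i V^(n - i) the preceding sum; then i =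
  n - j.\<close>

lemma csq_eq_sum_binomial:
  "csq n (z + V) V = (\<Sum>j\<le>n. real (n choose j) * real ((n + j) choose j) * V ^ j * z ^ (n - j))"
proof -
  have "csq n (z + V) V = (\<Sum>m\<le>n. \<Sum>i\<le>n. real ((n choose m) * (n choose m) * (m choose i)) * (z ^ i * V ^ (n - i)))"
    unfolding csq_def
  proof (rule sum.cong)
    fix m assume m: "m \<in> {..n}"
    have "(z + V) ^ m * V ^ (n - m) = (\<Sum>i\<le>m. real (m choose i) * (z ^ i * V ^ (n - i)))"
      unfolding binomial_ring sum_distrib_right
    proof (rule sum.cong)
      fix i assume "i \<in> {..m}"
      then have "V ^ (n - i) = V ^ (m - i) * V ^ (n - m)"
        using m by (simp flip: power_add)
      then show "of_nat (m choose i) * z ^ i * V ^ (m - i) * V ^ (n - m) = real (m choose i) * (z ^ i * V ^ (n - i))"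
        by simp
    qed simp
    also have "\<dots> = (\<Sum>i\<le>n. real (m choose i) * (z ^ i * V ^ (n - i)))"
      using m by (intro sum.mono_neutral_left) auto
    finally show "(real (n choose m))^2 * (z + V) ^ m * V ^ (n - m)
        = (\<Sum>i\<le>n. real ((n choose m) * (n choose m) * (m choose i)) * (z ^ i * V ^ (n - i)))"
      by (simp add: mult.assoc power2_eq_square sum_distrib_left)
  qed simp
  also have "\<dots> = (\<Sum>i\<le>n. real (\<Sum>m\<le>n. (n choose m) * (n choose m) * (m choose i)) * (z ^ i * V ^ (n - i)))"
    by (subst sum.swap) (simp only: of_nat_sum sum_distrib_right)
  also have "\<dots> = (\<Sum>i\<le>n. real ((n choose i) * ((2 * n - i) choose n)) * (z ^ i * V ^ (n - i)))"
    by (intro sum.cong) (simp_all only: sum_binomial_sq_binomial atMost_iff)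
  also have "\<dots> = (\<Sum>j\<le>n. real (n choose j) * real ((n + j) choose j) * V ^ j * z ^ (n - j))"
  proof (rule sum.reindex_bij_witness[of _ "\<lambda>j. n - j" "\<lambda>j. n - j"])
    fix i assume i: "i \<in> {..n}"
    then have "2 * n - i = n + (n - i)" "n choose (n - i) = n choose i"
      by (auto simp: binomial_symmetric[symmetric])
    moreover have "(n + (n - i)) choose (n - i) = (n + (n - i)) choose n"
      using binomial_symmetric[of n "n + (n - i)"] by simp
    ultimately show "real (n choose (n - i)) * real ((n + (n - i)) choose (n - i)) * V ^ (n - i) * z ^ (n - (n - i))
        = real ((n choose i) * ((2 * n - i) choose n)) * (z ^ i * V ^ (n - i))"
      using i by simp
  qed auto
  finally show ?thesis .
qed

text \<open>With V = (x - 1) / 2 * z, the sign of \<open>pochhammer (- real n) j\<close> is absorbed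
  by V ^ j, so the hypergeometric sum is the expansion above. Nothing is divided by z, so z = 0 is
  covered.\<close>

lemma legendre_eq_csq: "legendre n x * z ^ n = csq n ((x + 1) / 2 * z) ((x - 1) / 2 * z)"
proof -
  define V where "V = (x - 1) / 2 * z"
  have "pochhammer (- real n) j * pochhammer (real n + 1) j / (fact j * fact j) * ((1 - x) / 2) ^ j * z ^ n
     = real (n choose j) * real ((n + j) choose j) * V ^ j * z ^ (n - j)" if "j \<le> n" for j
  proof -
    have "real (n choose j) = (- 1) ^ j * (pochhammer (- real n) j / fact j)"
      by (simp add: binomial_gbinomial gbinomial_pochhammer)
    then have 1: "(- 1) ^ j * real (n choose j) = pochhammer (- real n) j / fact j"
      by (simp add: power_mult_distrib[symmetric] mult.assoc[symmetric])
    have 2: "real ((n + j) choose j) = pochhammer (real n + 1) j / fact j"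
      by (simp add: binomial_gbinomial gbinomial_pochhammer')
    have 3: "z ^ n = z ^ j * z ^ (n - j)"
      using that by (simp flip: power_add)
    have 4: "V ^ j = (- 1) ^ j * (((1 - x) / 2) ^ j * z ^ j)"
      unfolding V_def power_mult_distrib[symmetric] by (simp add: field_simps)
    have "pochhammer (- real n) j * pochhammer (real n + 1) j / (fact j * fact j) * ((1 - x) / 2) ^ j * z ^ n
       = (pochhammer (- real n) j / fact j) * (pochhammer (real n + 1) j / fact j) * ((1 - x) / 2) ^ j * z ^ n"
      by simp
    also have "\<dots> = real (n choose j) * real ((n + j) choose j) * V ^ j * z ^ (n - j)"
      unfolding 1[symmetric] 2[symmetric] 3 4 by (simp only: ac_simps)
    finally show ?thesis .
  qed
  then have "legendre n x * z ^ n = csq n (z + V) V"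
    unfolding legendre_eq_sum csq_eq_sum_binomial sum_distrib_right by (intro sum.cong) auto
  also have "z + V = (x + 1) / 2 * z"
    by (simp add: V_def field_simps)
  finally show ?thesis by (simp add: V_def)
qed

subsection \<open>Legendre's relation\<close>

lemma ell_has_derivative_flux:
  assumes "0 < x" "x < 1"
  shows "(ell has_real_derivative ell_flux x / (x * (1 - x))) (at x)"
  using ell_has_derivative[of x] ell_flux_eq_deriv[of x] assms by simp

lemma ell_flux_div_tendsto: "((\<lambda>x. ell_flux x / x) \<longlongrightarrow> 1 / 4) (at 0)"
  using ell_flux_has_derivative[of 0] by (simp add: DERIV_def)

text \<open>
  By Landen's transformation \<open>ell (((1 - k) / (1 + k))\<^sup>2) / (1 + k)\<close> solves the same equation in k as
  \<open>ell (k\<^sup>2)\<close>, so the statement is the constancy of a Wronskian, evaluated as k tends to 1.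
\<close>
lemma legendre_relation:
  fixes k :: real
  assumes "0 < k" "k < 1"
  defines "s \<equiv> (1 - k) / (1 + k)"
  shows "2 * ell_flux (k^2) * ell (s^2) / (1 + k)
    + ell (k^2) * (k * s * ell (s^2) + (1 + k) * ell_flux (s^2)) = 1 / pi"
proof -
  define \<sigma> where "\<sigma> k = (1 - k) / (1 + k)" for k :: real
  \<comment> \<open>This is k (1 - k^2) (F' H - F H') for F k = \<open>ell (k^2)\<close> and H k =
    \<open>ell ((\<sigma> k)^2) / (1 + k)\<close>, with the derivatives written through the
    fluxes.\<close>
  define W where "W k = 2 * ell_flux (k^2) * ell ((\<sigma> k)^2) / (1 + k)
    + ell (k^2) * (k * \<sigma> k * ell ((\<sigma> k)^2) + (1 + k) * ell_flux ((\<sigma> k)^2))" for k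
  have \<sigma>: "0 < \<sigma> k" "\<sigma> k < 1" "(\<sigma> k)^2 < 1" "0 < (\<sigma> k)^2" "k^2 < 1" "0 < k^2"
    if "0 < k" "k < 1" for k
  proof -
    show "0 < \<sigma> k" "\<sigma> k < 1"
      using that by (auto simp: \<sigma>_def)
    then show "(\<sigma> k)^2 < 1" "0 < (\<sigma> k)^2" "k^2 < 1" "0 < k^2"
      using that by (auto simp: power_less_one_iff)
  qed
  have d\<sigma>: "(\<sigma> has_real_derivative - 2 / (1 + k)^2) (at k)" if "0 < k" for k
    unfolding \<sigma>_def[abs_def] using that
    by (auto intro!: derivative_eq_intros simp: power2_eq_square divide_simps)
  have dW: "(W has_real_derivative 0) (at k)" if k: "0 < k" "k < 1" for k
  proof -
    define f f1 g g1 where "f = ell (k^2)" and "f1 = ell_flux (k^2)"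
      and "g = ell ((\<sigma> k)^2)" and "g1 = ell_flux ((\<sigma> k)^2)"
    have 1: "((\<lambda>k. ell (k^2)) has_real_derivative 2 * f1 / (k * (1 - k^2))) (at k)"
      by (rule DERIV_cong[OF DERIV_chain2[OF ell_has_derivative_flux]])
        (use \<sigma>[OF k] k in \<open>auto intro!: derivative_eq_intros simp: f1_def power2_eq_square\<close>)
    have 2: "((\<lambda>k. ell_flux (k^2)) has_real_derivative k * f / 2) (at k)"
      by (rule DERIV_cong[OF DERIV_chain2[OF ell_flux_has_derivative]])
        (use \<sigma>[OF k] k in \<open>auto intro!: derivative_eq_intros simp: f_def\<close>)
    have sq: "((\<lambda>k. (\<sigma> k)^2) has_real_derivative - 4 * \<sigma> k / (1 + k)^2) (at k)"
      using k by (auto intro!: derivative_eq_intros d\<sigma>)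
    \<comment> \<open>Turns the chain-rule factor - 4 \<sigma> / (1 + k)^2 divided by \<sigma>^2 (1
      - \<sigma>^2) into - 1 / (k \<sigma>).\<close>
    have co: "1 - (\<sigma> k)^2 = 4 * k / (1 + k)^2"
      using k by (simp add: \<sigma>_def divide_simps) (simp add: power2_eq_square algebra_simps)
    have 3: "((\<lambda>k. ell ((\<sigma> k)^2)) has_real_derivative - g1 / (k * \<sigma> k)) (at k)"
      by (rule DERIV_cong[OF DERIV_chain2[OF ell_has_derivative_flux sq]])
        (use \<sigma>[OF k] k in \<open>auto simp: g1_def[symmetric] co\<close>, simp add: power2_eq_square)
    have 4: "((\<lambda>k. ell_flux ((\<sigma> k)^2)) has_real_derivative - g * \<sigma> k / (1 + k)^2) (at k)"
      by (rule DERIV_cong[OF DERIV_chain2[OF ell_flux_has_derivative sq]])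
        (use \<sigma>[OF k] k in \<open>auto simp: g_def[symmetric]\<close>)
    have 5: "((\<lambda>k. 1 + k) has_real_derivative 1) (at k)"
      by (auto intro!: derivative_eq_intros)
    have "(W has_real_derivative
       ((2 * (k * f / 2) * g + 2 * f1 * (- g1 / (k * \<sigma> k))) * (1 + k) - 2 * f1 * g) / (1 + k)^2
       + (2 * f1 / (k * (1 - k^2))) * (k * \<sigma> k * g + (1 + k) * g1)
       + f * ((\<sigma> k + k * (- 2 / (1 + k)^2)) * g + k * \<sigma> k * (- g1 / (k * \<sigma> k)) + g1
         + (1 + k) * (- g * \<sigma> k / (1 + k)^2))) (at k)"
      unfolding W_def[abs_def]
      by (rule DERIV_cong[OF DERIV_add[OF DERIV_divide[OF DERIV_mult[OF DERIV_cmult[OF 2] 3] 5]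
            DERIV_mult[OF 1 DERIV_add[OF DERIV_mult[OF DERIV_mult[OF DERIV_ident d\<sigma>[OF k(1)]] 3]
              DERIV_mult[OF 5 4]]]]])
        (use k in \<open>auto simp: f_def f1_def g_def g1_def power2_eq_square algebra_simps\<close>)
    also have "2 * f1 / (k * (1 - k^2)) = 2 * f1 / (k * (1 - k) * (1 + k))"
      by (simp add: power2_eq_square algebra_simps)
    also have "((2 * (k * f / 2) * g + 2 * f1 * (- g1 / (k * \<sigma> k))) * (1 + k) - 2 * f1 * g) / (1 + k)^2
       + 2 * f1 / (k * (1 - k) * (1 + k)) * (k * \<sigma> k * g + (1 + k) * g1)
       + f * ((\<sigma> k + k * (- 2 / (1 + k)^2)) * g + k * \<sigma> k * (- g1 / (k * \<sigma> k)) + g1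
         + (1 + k) * (- g * \<sigma> k / (1 + k)^2)) = 0"
      using k by (simp add: \<sigma>_def divide_simps) (simp add: power2_eq_square algebra_simps)
    finally show ?thesis .
  qed
  have const: "W x = W k" if "0 < x" "x < 1" for x
    using that assms has_field_derivative_zero_constant[of "{0<..<1}" W]
    by (metis DERIV_subset convex_real_interval(8) dW greaterThanLessThan_iff has_field_derivative_at_within)
  have ev: "eventually (\<lambda>x::real. x \<in> {0<..<1}) (at_left 1)"
    by (rule eventually_at_leftI[of 0]) auto
  have sq1: "filterlim (\<lambda>x::real. x^2) (at_left 1) (at_left 1)"
    unfolding filterlim_at
  proof
    show "eventually (\<lambda>x::real. x^2 \<in> {..<1} \<and> x^2 \<noteq> 1) (at_left 1)"
      using ev by eventually_elim (use \<sigma> in fastforce)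
    show "((\<lambda>x::real. x^2) \<longlongrightarrow> 1) (at_left 1)"
      by (auto intro!: tendsto_eq_intros)
  qed
  have \<sigma>0: "(\<sigma> \<longlongrightarrow> 0) (at_left 1)"
    unfolding \<sigma>_def[abs_def] by (auto intro!: tendsto_eq_intros)
  have sq0: "filterlim (\<lambda>x. (\<sigma> x)^2) (at 0) (at_left 1)"
    unfolding filterlim_at
  proof
    show "eventually (\<lambda>x. (\<sigma> x)^2 \<in> UNIV \<and> (\<sigma> x)^2 \<noteq> 0) (at_left 1)"
      using ev by eventually_elim (use \<sigma> in fastforce)
    show "((\<lambda>x. (\<sigma> x)^2) \<longlongrightarrow> 0) (at_left 1)"
      using tendsto_power[OF \<sigma>0, of 2] by simp
  qed
  have g: "((\<lambda>x. ell ((\<sigma> x)^2)) \<longlongrightarrow> 1) (at_left 1)"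
    using filterlim_compose[OF isContD[OF DERIV_isCont[OF ell_has_derivative[of 0]]] sq0] by simp
  have f1: "((\<lambda>x. ell_flux (x^2)) \<longlongrightarrow> 1 / pi) (at_left 1)"
    by (rule filterlim_compose[OF ell_flux_at_left_1 sq1])
  have f: "((\<lambda>x. (1 - x^2) * ell (x^2)) \<longlongrightarrow> 0) (at_left 1)"
    by (rule filterlim_compose[OF ell_at_left_1 sq1])
  have g1: "((\<lambda>x. ell_flux ((\<sigma> x)^2) / (\<sigma> x)^2) \<longlongrightarrow> 1 / 4) (at_left 1)"
    by (rule filterlim_compose[OF ell_flux_div_tendsto sq0])
  \<comment> \<open>A factor 1 - x^2 is extracted from the second bracket of W to tame
    \<open>ell (x^2)\<close> as x tends to 1; only the first summand survives in the limit.\<close>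
  have "((\<lambda>x. 2 * ell_flux (x^2) * ell ((\<sigma> x)^2) / (1 + x)
     + ((1 - x^2) * ell (x^2)) * (x / (1 + x)^2 * ell ((\<sigma> x)^2)
         + \<sigma> x / (1 + x) * (ell_flux ((\<sigma> x)^2) / (\<sigma> x)^2)))
      \<longlongrightarrow> 2 * (1 / pi) * 1 / (1 + 1) + 0 * (1 / (1 + 1)^2 * 1 + 0 / (1 + 1) * (1 / 4))) (at_left 1)"
    by (intro tendsto_intros f f1 g g1 \<sigma>0) auto
  moreover have "eventually (\<lambda>x. 2 * ell_flux (x^2) * ell ((\<sigma> x)^2) / (1 + x)
     + ((1 - x^2) * ell (x^2)) * (x / (1 + x)^2 * ell ((\<sigma> x)^2)
         + \<sigma> x / (1 + x) * (ell_flux ((\<sigma> x)^2) / (\<sigma> x)^2)) = W k) (at_left 1)"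
    using ev
  proof eventually_elim
    fix x :: real assume "x \<in> {0<..<1}"
    then have x: "0 < x" "x < 1" by auto
    have 1: "(1 - x^2) * (x / (1 + x)^2) = x * \<sigma> x"
      using x by (simp add: \<sigma>_def divide_simps) (simp add: power2_eq_square algebra_simps)
    have "(1 - x^2) * (\<sigma> x / (1 + x)) = (1 + x) * (\<sigma> x)^2"
      using x by (simp add: \<sigma>_def divide_simps) (simp add: power2_eq_square algebra_simps)
    then have 2: "(1 - x^2) * (\<sigma> x / (1 + x)) * (ell_flux ((\<sigma> x)^2) / (\<sigma> x)^2) = (1 + x) * ell_flux ((\<sigma> x)^2)"
      using \<sigma>[OF x] by simp
    have "((1 - x^2) * ell (x^2)) * (x / (1 + x)^2 * ell ((\<sigma> x)^2)
         + \<sigma> x / (1 + x) * (ell_flux ((\<sigma> x)^2) / (\<sigma> x)^2))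
       = ell (x^2) * ((1 - x^2) * (x / (1 + x)^2) * ell ((\<sigma> x)^2)
         + (1 - x^2) * (\<sigma> x / (1 + x)) * (ell_flux ((\<sigma> x)^2) / (\<sigma> x)^2))"
      by (simp only: distrib_left ac_simps)
    also have "\<dots> = ell (x^2) * (x * \<sigma> x * ell ((\<sigma> x)^2) + (1 + x) * ell_flux ((\<sigma> x)^2))"
      unfolding 1 2 ..
    finally have eq: "((1 - x^2) * ell (x^2)) * (x / (1 + x)^2 * ell ((\<sigma> x)^2)
         + \<sigma> x / (1 + x) * (ell_flux ((\<sigma> x)^2) / (\<sigma> x)^2))
       = ell (x^2) * (x * \<sigma> x * ell ((\<sigma> x)^2) + (1 + x) * ell_flux ((\<sigma> x)^2))" .
    show "2 * ell_flux (x^2) * ell ((\<sigma> x)^2) / (1 + x)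
     + ((1 - x^2) * ell (x^2)) * (x / (1 + x)^2 * ell ((\<sigma> x)^2)
         + \<sigma> x / (1 + x) * (ell_flux ((\<sigma> x)^2) / (\<sigma> x)^2)) = W k"
      using const[OF x] unfolding eq W_def .
  qed
  ultimately have "((\<lambda>x::real. W k) \<longlongrightarrow> 1 / pi) (at_left 1)"
    by (simp add: filterlim_cong)
  then have "W k = 1 / pi"
    by (simp add: tendsto_const_iff)
  then show ?thesis
    by (simp add: W_def \<sigma>_def s_def)
qed

subsection \<open>Euler derivatives along a scaling path\<close>

text \<open>The operator x d/dx multiplies the n-th coefficient by n and keeps convergence on |x| <
  R, so it can be iterated.\<close>

lemma euler_power_series:
  fixes c :: "nat \<Rightarrow> real"
  assumes "\<And>x. \<bar>x\<bar> < R \<Longrightarrow> summable (\<lambda>n. c n * x ^ n)" "\<bar>x\<bar> < R"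
  shows "summable (\<lambda>n. real n * c n * x ^ n)"
    and "x \<noteq> 0 \<Longrightarrow> ((\<lambda>x. \<Sum>n. c n * x ^ n) has_real_derivative (\<Sum>n. real n * c n * x ^ n) / x) (at x)"
proof -
  obtain K where K: "\<bar>x\<bar> < K" "K < R"
    using dense[OF assms(2)] by blast
  have K_sum: "summable (\<lambda>n. c n * K ^ n)"
    using K by (intro assms(1)) auto
  have "summable (\<lambda>n. diffs c n * x ^ n)"
    using K by (intro termdiff_converges[of x R] assms) auto
  from sums_mult[OF summable_sums[OF this], of x]
  have "(\<lambda>n. real (Suc n) * c (Suc n) * x ^ Suc n) sums (x * (\<Sum>n. diffs c n * x ^ n))"
    by (simp add: diffs_def algebra_simps)
  then have s: "(\<lambda>n. real n * c n * x ^ n) sums (x * (\<Sum>n. diffs c n * x ^ n))"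
    by (subst (asm) sums_Suc_iff) simp
  then show "summable (\<lambda>n. real n * c n * x ^ n)"
    by (simp add: sums_iff)
  have "((\<lambda>x. \<Sum>n. c n * x ^ n) has_real_derivative (\<Sum>n. diffs c n * x ^ n)) (at x)"
    using K by (intro termdiffs_strong[OF K_sum]) auto
  then show "((\<lambda>x. \<Sum>n. c n * x ^ n) has_real_derivative (\<Sum>n. real n * c n * x ^ n) / x) (at x)" if "x \<noteq> 0"
    using s that by (simp add: sums_iff)
qed

lemma DERIV_eq_on_open:
  fixes A B :: "real \<Rightarrow> real"
  assumes "open I" "t \<in> I" "\<And>x. x \<in> I \<Longrightarrow> A x = B x"
    and "(A has_real_derivative a) (at t)" "(B has_real_derivative b) (at t)"
  shows "a = b"
  using has_field_derivative_transform_within_open[OF assms(4,1,2,3)] assms(5) DERIV_unique by blast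

text \<open>
  Applied to X, Y with \<open>X (1 - Y) = t U\<close>, \<open>Y (1 - X) = t V\<close> and to f, g, f1, g1 obtained by composing
  \<^const>\<open>ell\<close> and \<^const>\<open>ell_flux\<close> with them.
\<close>
lemma theta_derivatives:
  fixes X Y f f1 g g1 A0 A1 A2 A3 :: "real \<Rightarrow> real"
  defines "\<rho> \<equiv> \<lambda>t. 1 - X t - Y t"
    and "D \<equiv> \<lambda>t. X t * (1 - X t) + Y t * (1 - Y t)"
    and "E \<equiv> \<lambda>t. (1 - 2 * X t) * (X t * (1 - X t)) + (1 - 2 * Y t) * (Y t * (1 - Y t))"
    and "S \<equiv> \<lambda>t. f1 t * g t + f t * g1 t"
    and "Q \<equiv> \<lambda>t. (X t * (1 - X t) + Y t * (1 - Y t)) / 4 * (f t * g t) + 2 * (f1 t * g1 t)"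
    and "q \<equiv> \<lambda>t. (X t * (1 - X t) * (f t * g1 t) + Y t * (1 - Y t) * (f1 t * g t)) / 4"
  assumes I: "open I"
    and pos: "\<And>t. t \<in> I \<Longrightarrow> 0 < t" "\<And>t. t \<in> I \<Longrightarrow> 0 < 1 - X t - Y t"
    and dX: "\<And>t. t \<in> I \<Longrightarrow> (X has_real_derivative X t * (1 - X t) / (t * \<rho> t)) (at t)"
    and dY: "\<And>t. t \<in> I \<Longrightarrow> (Y has_real_derivative Y t * (1 - Y t) / (t * \<rho> t)) (at t)"
    and df: "\<And>t. t \<in> I \<Longrightarrow> (f has_real_derivative f1 t / (t * \<rho> t)) (at t)"
    and dg: "\<And>t. t \<in> I \<Longrightarrow> (g has_real_derivative g1 t / (t * \<rho> t)) (at t)"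
    and df1: "\<And>t. t \<in> I \<Longrightarrow> (f1 has_real_derivative X t * (1 - X t) * f t / 4 / (t * \<rho> t)) (at t)"
    and dg1: "\<And>t. t \<in> I \<Longrightarrow> (g1 has_real_derivative Y t * (1 - Y t) * g t / 4 / (t * \<rho> t)) (at t)"
    and dA0: "\<And>t. t \<in> I \<Longrightarrow> (A0 has_real_derivative A1 t / t) (at t)"
    and dA1: "\<And>t. t \<in> I \<Longrightarrow> (A1 has_real_derivative A2 t / t) (at t)"
    and dA2: "\<And>t. t \<in> I \<Longrightarrow> (A2 has_real_derivative A3 t / t) (at t)"
    and A0: "\<And>t. t \<in> I \<Longrightarrow> A0 t = f t * g t"
    and t: "t \<in> I"
  shows "A1 t = S t / \<rho> t"
    and "A2 t = Q t / \<rho> t ^ 2 + D t * S t / \<rho> t ^ 3"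
    and "A3 t = (E t * (f t * g t) / 4 + D t * S t / 4 + 2 * q t) / \<rho> t ^ 3
          + (E t * S t + 3 * (D t * Q t)) / \<rho> t ^ 4 + 3 * D t ^ 2 * S t / \<rho> t ^ 5"
proof -
  have nz: "t \<noteq> 0" "\<rho> t \<noteq> 0" if "t \<in> I" for t
    using pos[OF that] by (auto simp: \<rho>_def)
  note d = derivative_eq_intros dX dY df dg df1 dg1
  \<comment> \<open>Write d for t \<rho> times the derivative in t. It sends X to X (1 - X), f to
    f1, f1 to X (1 - X) f / 4, and likewise for Y, g, g1. Hence d \<rho> = - D, d D = E, d (f g) =
    S, d S = Q, d (f1 g1) = q, and each next A is d of the previous one divided by \<rho>.\<close>
  have d\<rho>: "(\<rho> has_real_derivative - D t / (t * \<rho> t)) (at t)" if "t \<in> I" for t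
    unfolding \<rho>_def[THEN meta_eq_to_obj_eq]
    by (rule d that refl)+ (simp add: D_def \<rho>_def diff_divide_distrib add_divide_distrib)
  have dD: "(D has_real_derivative E t / (t * \<rho> t)) (at t)" if "t \<in> I" for t
    unfolding D_def[THEN meta_eq_to_obj_eq]
    by (rule d that refl)+ (simp add: E_def algebra_simps diff_divide_distrib add_divide_distrib)
  have dfg: "((\<lambda>t. f t * g t) has_real_derivative S t / (t * \<rho> t)) (at t)" if "t \<in> I" for t
    by (rule d that refl)+ (simp add: S_def algebra_simps add_divide_distrib)
  have df1g1: "((\<lambda>t. f1 t * g1 t) has_real_derivative q t / (t * \<rho> t)) (at t)" if "t \<in> I" for t
    by (rule d that refl)+ (simp add: q_def algebra_simps add_divide_distrib diff_divide_distrib)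
  have dS: "(S has_real_derivative Q t / (t * \<rho> t)) (at t)" if "t \<in> I" for t
    unfolding S_def[THEN meta_eq_to_obj_eq]
    by (rule d that refl)+ (simp add: Q_def algebra_simps add_divide_distrib diff_divide_distrib)
  have Q_eq: "Q = (\<lambda>t. D t / 4 * (f t * g t) + 2 * (f1 t * g1 t))"
    by (simp add: Q_def D_def)
  have dQ: "(Q has_real_derivative (E t * (f t * g t) / 4 + D t * S t / 4 + 2 * q t) / (t * \<rho> t)) (at t)"
    if "t \<in> I" for t
    unfolding Q_eq
    by (rule DERIV_cong[OF DERIV_add[OF DERIV_mult[OF DERIV_cdivide[OF dD] dfg] DERIV_cmult[OF df1g1]]])
      (use that in \<open>simp_all add: algebra_simps add_divide_distrib\<close>)
  have A1: "A1 t = S t / \<rho> t" if "t \<in> I" for t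
    using DERIV_eq_on_open[OF I that A0 dA0[OF that] dfg[OF that]] nz[OF that]
    by (simp add: field_simps)
  then show "A1 t = S t / \<rho> t" using t .
  have A2: "A2 t = Q t / \<rho> t ^ 2 + D t * S t / \<rho> t ^ 3" if "t \<in> I" for t
  proof -
    have "((\<lambda>t. S t / \<rho> t) has_real_derivative
        (Q t / \<rho> t ^ 2 + D t * S t / \<rho> t ^ 3) / t) (at t)"
      by (rule derivative_eq_intros dS d\<rho> nz that refl)+
        (use nz[OF that] in \<open>simp add: divide_simps, simp add: algebra_simps eval_nat_numeral\<close>)
    from DERIV_eq_on_open[OF I that A1 dA1[OF that] this] nz[OF that] show ?thesis by simp
  qed
  then show "A2 t = Q t / \<rho> t ^ 2 + D t * S t / \<rho> t ^ 3" using t .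
  have "((\<lambda>t. Q t / \<rho> t ^ 2 + D t * S t / \<rho> t ^ 3) has_real_derivative
      ((E t * (f t * g t) / 4 + D t * S t / 4 + 2 * q t) / \<rho> t ^ 3
          + (E t * S t + 3 * (D t * Q t)) / \<rho> t ^ 4 + 3 * D t ^ 2 * S t / \<rho> t ^ 5) / t) (at t)"
    by (rule derivative_eq_intros dS dQ dD d\<rho> power_not_zero nz t refl)+
      (use nz[OF t] in \<open>simp add: divide_simps, simp add: algebra_simps eval_nat_numeral\<close>)
  from DERIV_eq_on_open[OF I t A2 dA2[OF t] this] nz[OF t]
  show "A3 t = (E t * (f t * g t) / 4 + D t * S t / 4 + 2 * q t) / \<rho> t ^ 3
          + (E t * S t + 3 * (D t * Q t)) / \<rho> t ^ 4 + 3 * D t ^ 2 * S t / \<rho> t ^ 5" by simp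
qed

subsection \<open>The series at the given parameters\<close>

text \<open>Apply \<open>legendre_eq_csq\<close> with z = arg_den / (1 + k)^2. Sum and difference of
  \<open>arg_num\<close> and \<open>arg_den\<close> factor as 8 k^3 and 2 (1 - k)^3 (1 + k), so the
  zero of \<open>arg_den\<close> disappears.\<close>

lemma legendre_power_eq_csq:
  assumes "0 < k" "k \<noteq> sqrt 2 - 1"
  shows "legendre_power n k = csq n (4 * k^3 / (1 + k)^2) ((1 - k)^3 / (1 + k)) / 16 ^ n"
proof -
  have nz: "arg_den k \<noteq> 0"
    using arg_den_eq_0_iff assms by blast
  have 1: "(arg_num k / arg_den k + 1) / 2 * (arg_den k / (1 + k)^2) = (arg_num k + arg_den k) / 2 / (1 + k)^2"
    unfolding divide_add_eq_iff[OF nz] using nz by simp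
  have 2: "(arg_num k / arg_den k - 1) / 2 * (arg_den k / (1 + k)^2) = (arg_num k - arg_den k) / 2 / (1 + k)^2"
    unfolding divide_diff_eq_iff[OF nz] using nz by simp
  have "arg_num k + arg_den k = 8 * k^3"
    by (simp add: arg_num_def arg_den_def eval_nat_numeral algebra_simps)
  then have 3: "(arg_num k + arg_den k) / 2 = 4 * k^3"
    by simp
  have "arg_num k - arg_den k = 2 * ((1 - k)^3 * (1 + k))"
    by (simp add: arg_num_def arg_den_def eval_nat_numeral algebra_simps)
  then have "(arg_num k - arg_den k) / 2 = (1 - k)^3 * (1 + k)"
    by simp
  then have 4: "(arg_num k - arg_den k) / 2 / (1 + k)^2 = (1 - k)^3 / (1 + k)"
    using assms by (simp add: power2_eq_square)
  have "legendre_power n k = legendre n (arg_num k / arg_den k) * (arg_den k / (1 + k)^2) ^ n / 16 ^ n"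
    by (simp add: legendre_power_def power_divide power_mult_distrib add.commute)
  then show ?thesis
    unfolding legendre_eq_csq 1 2 3 4 .
qed

text \<open>The right side is continuous for k > 0, so at \<open>sqrt 2 - 1\<close> it is the limit
  that defines the extension.\<close>

lemma legendre_power_ext_eq_csq:
  assumes "0 < k"
  shows "legendre_power_ext n k = csq n (4 * k^3 / (1 + k)^2) ((1 - k)^3 / (1 + k)) / 16 ^ n"
proof (cases "k = sqrt 2 - 1")
  case False
  then show ?thesis
    using legendre_power_eq_csq[OF assms] by (simp add: legendre_power_ext_def)
next
  case True
  let ?f = "\<lambda>k::real. csq n (4 * k^3 / (1 + k)^2) ((1 - k)^3 / (1 + k)) / 16 ^ n"
  have "isCont ?f k"
    unfolding csq_def using assms by (intro continuous_intros) auto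
  then have "(?f \<longlongrightarrow> ?f k) (at k)"
    by (simp add: isCont_def)
  moreover have "eventually (\<lambda>x. x \<in> {0<..}) (at k)"
    using assms by (intro eventually_at_in_open') auto
  then have "eventually (\<lambda>x. ?f x = legendre_power n x) (at k)"
    using eventually_neq_at_within[of k k UNIV]
    by eventually_elim (use True in \<open>simp add: legendre_power_eq_csq\<close>)
  ultimately have "(legendre_power n \<longlongrightarrow> ?f k) (at k)"
    by (rule Lim_transform_eventually)
  then have "Lim (at k) (legendre_power n) = ?f k"
    by (intro tendsto_Lim) auto
  with True show ?thesis
    by (simp add: legendre_power_ext_def)
qed

text \<open>With c = (1 + k)^2 one has C3 = 4 c^2 \<rho>^2 and C2 = - 12 c^2 D. Hence the Q terms,
  which contain f1 g1, and the D^2 S terms cancel. C1 and C0 then adjust the coefficients of f1 g, f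
  g1 and f g to those of Legendre's relation.\<close>

lemma ramanujan_combination:
  fixes k f f1 g g1 :: real
  assumes k: "0 < k" "k < 1"
  defines "X \<equiv> k^2" and "s \<equiv> (1 - k) / (1 + k)"
  defines "Y \<equiv> s^2"
  defines "\<rho> \<equiv> 1 - X - Y"
    and "D \<equiv> X * (1 - X) + Y * (1 - Y)"
    and "E \<equiv> (1 - 2 * X) * (X * (1 - X)) + (1 - 2 * Y) * (Y * (1 - Y))"
    and "S \<equiv> f1 * g + f * g1"
    and "q \<equiv> (X * (1 - X) * (f * g1) + Y * (1 - Y) * (f1 * g)) / 4"
  defines "Q \<equiv> D / 4 * (f * g) + 2 * (f1 * g1)"
  shows "C3 k * ((E * (f * g) / 4 + D * S / 4 + 2 * q) / \<rho> ^ 3 + (E * S + 3 * (D * Q)) / \<rho> ^ 4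
        + 3 * D ^ 2 * S / \<rho> ^ 5)
      + C2 k * (Q / \<rho> ^ 2 + D * S / \<rho> ^ 3) + C1 k * (S / \<rho>) + C0 k * (f * g)
     = 2 * (k + 1)^3 * (k^2 + 1) * (2 * f1 * g / (1 + k) + f * (k * s * g + (1 + k) * g1))"
proof -
  \<comment> \<open>Clears the denominator of Y: c Y = (1 - k)^2.\<close>
  define c where "c = (1 + k)^2"
  \<comment> \<open>The quotient E / \<rho>, as a polynomial in X + Y and X Y.\<close>
  define e where "e = (X + Y) * (1 - 2 * (X + Y)) + 6 * (X * Y)"
  have Y1: "c * Y = (1 - k)^2"
    using k by (simp add: c_def Y_def s_def power_divide)
  have c\<rho>: "c * \<rho> = k * (1 - k) * (k^2 + 3 * k + 4)"
    using Y1 unfolding \<rho>_def right_diff_distrib by (simp add: X_def c_def eval_nat_numeral algebra_simps)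
  then have \<rho>: "\<rho> \<noteq> 0"
    using k by (auto simp: add_pos_pos less_imp_neq[symmetric] zero_less_power)
  have cY: "c * (c * Y) = c * (1 - k)^2"
    unfolding Y1 ..
  have Y2: "c^2 * Y = c * (1 - k)^2" "c^2 * Y^2 = (1 - k)^4"
    "c^2 * (X * Y) = c * (k^2 * (1 - k)^2)"
    using cY arg_cong[OF cY, of "\<lambda>x. k^2 * x"] arg_cong[OF Y1, of "\<lambda>x. x^2"]
    by (simp_all add: power_mult_distrib X_def power2_eq_square[of c] ac_simps del: mult_cancel_left)
  have E: "E = \<rho> * e"
    by (simp add: E_def \<rho>_def e_def algebra_simps)
  have C3: "C3 k = 4 * c^2 * \<rho>^2"
    using arg_cong[OF c\<rho>, of "\<lambda>x. 4 * x^2"]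
    by (simp add: C3_def power_mult_distrib power2_commute ac_simps)
  have cP: "c^2 * (X * (1 - X)) = c^2 * (k^2 * (1 - k^2))"
    by (simp add: X_def)
  have cR: "c^2 * (Y * (1 - Y)) = c * (1 - k)^2 - (1 - k)^4"
    unfolding Y2[symmetric] by (simp add: power2_eq_square algebra_simps)
  have ce: "c^2 * e = c^2 * k^2 + c * (1 - k)^2 - 2 * (c^2 * k^4 + 2 * (c * (k^2 * (1 - k)^2)) + (1 - k)^4)
      + 6 * (c * (k^2 * (1 - k)^2))"
    unfolding Y2[symmetric] by (simp add: e_def X_def power2_eq_square algebra_simps eval_nat_numeral)
  have C2: "C2 k = - 12 * (c^2 * D)"
    unfolding D_def distrib_left cP cR
    by (simp add: C2_def c_def) algebra
  have C0: "c^2 * e + C0 k = 2 * (k + 1)^2 * (k^2 + 1) * k * (1 - k)"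
    unfolding ce by (simp add: C0_def c_def) algebra
  \<comment> \<open>This and \<open>fg1\<close> are the coefficients of f1 g and f g1 before
    division by \<rho>. Their ratio is 2 : (k + 1)^2, as in
    \<open>legendre_relation\<close>.\<close>
  have f1g: "c^2 * (D + 2 * (Y * (1 - Y)) + 4 * e) + C1 k = 4 * (c * \<rho>) * (k^2 + 1)"
  proof -
    have eq: "c^2 * (D + 2 * (Y * (1 - Y)) + 4 * e) + C1 k
        = c^2 * (X * (1 - X)) + 3 * (c^2 * (Y * (1 - Y))) + 4 * (c^2 * e) + C1 k"
      by (simp add: D_def algebra_simps)
    show ?thesis
      unfolding eq cP cR ce c\<rho> by (simp add: C1_def c_def) algebra
  qed
  have fg1: "c^2 * (D + 2 * (X * (1 - X)) + 4 * e) + C1 k = 2 * (c * \<rho>) * (k + 1)^2 * (k^2 + 1)"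
  proof -
    have eq: "c^2 * (D + 2 * (X * (1 - X)) + 4 * e) + C1 k
        = 3 * (c^2 * (X * (1 - X))) + c^2 * (Y * (1 - Y)) + 4 * (c^2 * e) + C1 k"
      by (simp add: D_def algebra_simps)
    show ?thesis
      unfolding eq cP cR ce c\<rho> by (simp add: C1_def c_def) algebra
  qed
  have C3_div: "C3 k * (x / \<rho> ^ 3) = 4 * c^2 * x / \<rho>" "C3 k * (x / \<rho> ^ 4) = 4 * c^2 * x / \<rho>^2"
    "C3 k * (x / \<rho> ^ 5) = 4 * c^2 * x / \<rho>^3" for x
    unfolding C3 using \<rho> by (simp_all add: eval_nat_numeral)
  have E_div: "(E * (f * g) / 4 + x) / \<rho> = e * (f * g) / 4 + x / \<rho>" "(E * S + x) / \<rho>^2 = e * S / \<rho> + x / \<rho>^2" for x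
    unfolding E using \<rho> by (simp_all add: add_divide_distrib power2_eq_square)
  have "C3 k * ((E * (f * g) / 4 + D * S / 4 + 2 * q) / \<rho> ^ 3 + (E * S + 3 * (D * Q)) / \<rho> ^ 4
        + 3 * D ^ 2 * S / \<rho> ^ 5)
      + C2 k * (Q / \<rho> ^ 2 + D * S / \<rho> ^ 3) + C1 k * (S / \<rho>) + C0 k * (f * g)
    = (c^2 * e + C0 k) * (f * g) + (c^2 * (D * S + 8 * q + 4 * e * S) + C1 k * S) / \<rho>"
    unfolding distrib_left[of "C3 k"] C3_div times_divide_eq_right[of "4 * c^2", symmetric]
      add.assoc[of "E * (f * g) / 4"] E_div C2
    by (simp add: algebra_simps add_divide_distrib power2_eq_square)
  also have q8: "8 * q = 2 * (X * (1 - X) * (f * g1) + Y * (1 - Y) * (f1 * g))"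
    by (simp add: q_def)
  also have "c^2 * (D * S + 2 * (X * (1 - X) * (f * g1) + Y * (1 - Y) * (f1 * g)) + 4 * e * S) + C1 k * S
     = (c^2 * (D + 2 * (Y * (1 - Y)) + 4 * e) + C1 k) * (f1 * g)
      + (c^2 * (D + 2 * (X * (1 - X)) + 4 * e) + C1 k) * (f * g1)"
    by (simp add: S_def algebra_simps)
  also have "\<dots> / \<rho> = 4 * c * (k^2 + 1) * (f1 * g) + 2 * c * (k + 1)^2 * (k^2 + 1) * (f * g1)"
    unfolding f1g fg1 using \<rho> by (simp add: divide_simps) (simp add: algebra_simps)
  also have "(c^2 * e + C0 k) * (f * g) = 2 * (k + 1)^2 * (k^2 + 1) * k * (1 - k) * (f * g)"
    unfolding C0 ..
  finally have "C3 k * ((E * (f * g) / 4 + D * S / 4 + 2 * q) / \<rho> ^ 3 + (E * S + 3 * (D * Q)) / \<rho> ^ 4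
        + 3 * D ^ 2 * S / \<rho> ^ 5)
      + C2 k * (Q / \<rho> ^ 2 + D * S / \<rho> ^ 3) + C1 k * (S / \<rho>) + C0 k * (f * g)
    = 2 * (k + 1)^2 * (k^2 + 1) * (2 * f1 * g + f * (k * (1 - k) * g + (1 + k)^2 * g1))"
    by (simp add: c_def algebra_simps power2_eq_square)
  also have "2 * f1 * g + f * (k * (1 - k) * g + (1 + k)^2 * g1)
      = (k + 1) * (2 * f1 * g / (1 + k) + f * (k * s * g + (1 + k) * g1))"
    using k by (simp add: s_def divide_simps) (simp add: power2_eq_square algebra_simps)
  finally show ?thesis
    by (simp add: power3_eq_cube power2_eq_square)
qed

section \<open>Assembly of the series\<close>

theorem theorem1:
  fixes k :: real
  assumes "0 < k" and "k < 1"
  shows "(\<lambda>n. (real ((2 * n) choose n))^2 * legendre_power_ext n k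
            * (C3 k * real n ^ 3 + C2 k * real n ^ 2 + C1 k * real n + C0 k))
         sums (2 * (k + 1)^3 * (k^2 + 1) / pi)"
proof -
  define s where "s = (1 - k) / (1 + k)"
  define X0 Y0 where "X0 = k^2" and "Y0 = s^2"
  define U V where "U = X0 * (1 - Y0)" and "V = Y0 * (1 - X0)"
  have s: "0 < s" "s < 1"
    using assms by (auto simp: s_def)
  have XY: "0 < X0" "X0 < 1" "0 < Y0" "Y0 < 1"
    using assms s by (auto simp: X0_def Y0_def power_less_one_iff)
  have "1 - X0 - Y0 = k * (1 - k) * (k^2 + 3 * k + 4) / (1 + k)^2"
    using assms by (simp add: X0_def Y0_def s_def divide_simps) (simp add: eval_nat_numeral algebra_simps)
  moreover have "0 < k * (1 - k) * (k^2 + 3 * k + 4) / (1 + k)^2"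
    using assms by (intro divide_pos_pos mult_pos_pos add_pos_pos) auto
  ultimately have \<rho>0: "0 < 1 - X0 - Y0" by simp
  have UV: "U = 4 * k^3 / (1 + k)^2" "V = (1 - k)^3 / (1 + k)" "0 \<le> U" "0 \<le> V"
    using assms XY
    by (simp_all add: U_def V_def)
      (simp_all add: X0_def Y0_def s_def divide_simps, simp_all add: eval_nat_numeral algebra_simps)

  define a where "a n = cbin2 n * csq n U V" for n
  define r where "r = (sqrt U + sqrt V)^2"
  have r: "0 \<le> r" "r < 1"
    using sqrt_sum_less_1[of X0 Y0] XY \<rho>0 by (auto simp: r_def U_def V_def)
  \<comment> \<open>A radius with R > 1 and r R < 1, so that t = 1 is an interior point of
    convergence.\<close>
  define R where "R = 2 / (1 + r)"
  have R: "1 < R" "r * R < 1"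
    using r by (auto simp: R_def field_simps)
  have a_sum: "summable (\<lambda>n. a n * x ^ n)" if "\<bar>x\<bar> < R" for x
  proof (rule summable_comparison_test')
    have "r * \<bar>x\<bar> \<le> r * R"
      using that r by (intro mult_left_mono) auto
    then show "summable (\<lambda>n. (r * \<bar>x\<bar>) ^ n)"
      using R r by (intro summable_geometric) (auto simp: abs_mult)
    show "norm (a n * x ^ n) \<le> (r * \<bar>x\<bar>) ^ n" for n
    proof -
      have "a n \<le> 1 * r ^ n"
        unfolding a_def r_def
        using UV by (intro mult_mono cbin2_le_1 csq_le csq_nonneg) auto
      moreover have "0 \<le> a n"
        using UV by (simp add: a_def csq_nonneg less_imp_le[OF cbin2_pos])
      ultimately show ?thesis
        by (simp add: abs_mult power_abs power_mult_distrib mult_right_mono)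
    qed
  qed
  have a1_sum: "summable (\<lambda>n. real n * a n * x ^ n)" if "\<bar>x\<bar> < R" for x
    by (rule euler_power_series(1)[of R, OF a_sum that])
  have a2_sum: "summable (\<lambda>n. real n * (real n * a n) * x ^ n)" if "\<bar>x\<bar> < R" for x
    by (rule euler_power_series(1)[of R, OF a1_sum that])
  have a3_sum: "summable (\<lambda>n. real n * (real n * (real n * a n)) * x ^ n)" if "\<bar>x\<bar> < R" for x
    by (rule euler_power_series(1)[of R, OF a2_sum that])
  define A0 where "A0 t = (\<Sum>n. a n * t ^ n)" for t
  define A1 where "A1 t = (\<Sum>n. real n * a n * t ^ n)" for t
  define A2 where "A2 t = (\<Sum>n. real n * (real n * a n) * t ^ n)" for t
  define A3 where "A3 t = (\<Sum>n. real n * (real n * (real n * a n)) * t ^ n)" for t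

  \<comment> \<open>These solve X (1 - Y) = t U, Y (1 - X) = t V: the difference gives X - Y = z t,
    and (1 - X - Y)^2 = h t. The positive root selects the branch with X + Y < 1, which passes
    through X0, Y0 at t = 1.\<close>
  define w z where "w = U + V" and "z = U - V"
  define h where "h t = 1 - 2 * w * t + z^2 * t^2" for t
  define X where "X t = (1 - sqrt (h t) + z * t) / 2" for t
  define Y where "Y t = (1 - sqrt (h t) - z * t) / 2" for t
  \<comment> \<open>All conditions are strict and hold at t = 1, so this is an open neighbourhood of
    1.\<close>
  define I where "I = {t. 0 < t} \<inter> {t. t < R} \<inter> {t. 0 < h t} \<inter> {t. 0 < X t} \<inter> {t. 0 < Y t}"
  have "open I"
  proof -
    have h: "continuous_on UNIV h"
      unfolding h_def by (intro continuous_intros)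
    then have "continuous_on UNIV X" "continuous_on UNIV Y"
      unfolding X_def Y_def by (auto intro!: continuous_intros)
    with h show ?thesis
      unfolding I_def by (intro open_Int open_Collect_less continuous_on_const continuous_on_id)
  qed
  have I: "0 < t" "t < R" "0 < h t" "0 < X t" "0 < Y t" "1 - X t - Y t = sqrt (h t)" "X t < 1" "Y t < 1"
    if "t \<in> I" for t
  proof -
    show 1: "0 < t" "t < R" "0 < h t" "0 < X t" "0 < Y t"
      using that by (auto simp: I_def)
    show 2: "1 - X t - Y t = sqrt (h t)"
      by (simp add: X_def Y_def field_simps)
    have "0 < sqrt (h t)" using 1 by simp
    with 1 2 show "X t < 1" "Y t < 1" by linarith+
  qed
  have "h 1 = (1 - X0 - Y0)^2"
    by (simp add: h_def w_def z_def U_def V_def power2_eq_square algebra_simps)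
  then have h1: "sqrt (h 1) = 1 - X0 - Y0" "0 < h 1"
    using \<rho>0 by auto
  have at_1: "X 1 = X0" "Y 1 = Y0"
    unfolding X_def Y_def h1 z_def U_def V_def by (simp_all add: algebra_simps)
  have "1 \<in> I"
    using R h1 XY at_1 by (simp add: I_def)
  have dh: "((\<lambda>t. sqrt (h t)) has_real_derivative (z^2 * t - w) / sqrt (h t)) (at t)" if "t \<in> I" for t
    using I(3)[OF that] unfolding h_def
    by (auto intro!: derivative_eq_intros simp: divide_simps)
  \<comment> \<open>All four identities follow from squaring sqrt (h t). The first two match the
    numerators that appear when X and Y are differentiated.\<close>
  have X_prod: "X t * (1 - X t) = t * (w - z^2 * t + sqrt (h t) * z) / 2"
    and Y_prod: "Y t * (1 - Y t) = t * (w - z^2 * t - sqrt (h t) * z) / 2"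
    and XU: "X t * (1 - Y t) = t * U" and YV: "Y t * (1 - X t) = t * V" if "t \<in> I" for t
  proof -
    define m where "m = sqrt (h t)"
    have "m * m = 1 - 2 * w * t + z^2 * t^2"
      using I(3)[OF that] by (simp add: m_def h_def)
    then show "X t * (1 - X t) = t * (w - z^2 * t + sqrt (h t) * z) / 2"
        "Y t * (1 - Y t) = t * (w - z^2 * t - sqrt (h t) * z) / 2"
        "X t * (1 - Y t) = t * U" "Y t * (1 - X t) = t * V"
      unfolding X_def Y_def m_def[symmetric]
      by (simp_all add: w_def z_def power2_eq_square field_simps)
  qed
  have dX: "(X has_real_derivative X t * (1 - X t) / (t * (1 - X t - Y t))) (at t)"
    and dY: "(Y has_real_derivative Y t * (1 - Y t) / (t * (1 - X t - Y t))) (at t)" if "t \<in> I" for t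
  proof -
    show "(X has_real_derivative X t * (1 - X t) / (t * (1 - X t - Y t))) (at t)"
      unfolding X_prod[OF that] I(6)[OF that] unfolding X_def[abs_def]
      by (rule DERIV_cong[OF DERIV_cdivide[OF DERIV_add[OF DERIV_diff[OF DERIV_const dh[OF that]]
              DERIV_cmult[OF DERIV_ident]]]])
        (use I(1,3)[OF that] in \<open>simp add: divide_simps\<close>)
    show "(Y has_real_derivative Y t * (1 - Y t) / (t * (1 - X t - Y t))) (at t)"
      unfolding Y_prod[OF that] I(6)[OF that] unfolding Y_def[abs_def]
      by (rule DERIV_cong[OF DERIV_cdivide[OF DERIV_diff[OF DERIV_diff[OF DERIV_const dh[OF that]]
              DERIV_cmult[OF DERIV_ident]]]])
        (use I(1,3)[OF that] in \<open>simp add: divide_simps\<close>)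
  qed
  have \<rho>_pos: "0 < 1 - X t - Y t" if "t \<in> I" for t
    using I(3,6)[OF that] by simp
  \<comment> \<open>The arguments of \<open>csq\<close> are t U and t V here, so by homogeneity
    Brafman's sum is the power series \<open>A0 t\<close>.\<close>
  have "(\<lambda>N. cbin2 N * csq N (X t * (1 - Y t)) (Y t * (1 - X t))) sums (ell (X t) * ell (Y t))" if "t \<in> I" for t
    using I(4,5)[OF that] \<rho>_pos[OF that] by (intro brafman) auto
  then have A0: "A0 t = ell (X t) * ell (Y t)" if "t \<in> I" for t
    using that by (simp add: A0_def a_def XU YV csq_scale sums_iff ac_simps)
  have IR: "\<bar>t\<bar> < R" "t \<noteq> 0" if "t \<in> I" for t
    using I(1,2)[OF that] by auto
  have df: "((\<lambda>t. ell (X t)) has_real_derivative ell_flux (X t) / (t * (1 - X t - Y t))) (at t)"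
    "((\<lambda>t. ell_flux (X t)) has_real_derivative X t * (1 - X t) * ell (X t) / 4 / (t * (1 - X t - Y t))) (at t)"
    if "t \<in> I" for t
    using I[OF that]
    by (auto intro!: DERIV_cong[OF DERIV_chain2[OF ell_has_derivative_flux dX[OF that]]]
        DERIV_cong[OF DERIV_chain2[OF ell_flux_has_derivative dX[OF that]]])
  have dg: "((\<lambda>t. ell (Y t)) has_real_derivative ell_flux (Y t) / (t * (1 - X t - Y t))) (at t)"
    "((\<lambda>t. ell_flux (Y t)) has_real_derivative Y t * (1 - Y t) * ell (Y t) / 4 / (t * (1 - X t - Y t))) (at t)"
    if "t \<in> I" for t
    using I[OF that]
    by (auto intro!: DERIV_cong[OF DERIV_chain2[OF ell_has_derivative_flux dY[OF that]]]
        DERIV_cong[OF DERIV_chain2[OF ell_flux_has_derivative dY[OF that]]])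
  have dA: "(A0 has_real_derivative A1 t / t) (at t)" "(A1 has_real_derivative A2 t / t) (at t)"
    "(A2 has_real_derivative A3 t / t) (at t)" if "t \<in> I" for t
    unfolding A0_def[abs_def] A1_def[abs_def] A2_def[abs_def] A3_def
    by (rule euler_power_series(2)[OF a_sum IR[OF that]] euler_power_series(2)[OF a1_sum IR[OF that]]
        euler_power_series(2)[OF a2_sum IR[OF that]], assumption)+
  note thetas = theta_derivatives[OF \<open>open I\<close> I(1) \<rho>_pos dX dY df(1) dg(1) df(2) dg(2) dA A0 \<open>1 \<in> I\<close>,
      unfolded at_1]
  have "C3 k * A3 1 + C2 k * A2 1 + C1 k * A1 1 + C0 k * A0 1
     = 2 * (k + 1)^3 * (k^2 + 1) * (2 * ell_flux X0 * ell Y0 / (1 + k)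
        + ell X0 * (k * s * ell Y0 + (1 + k) * ell_flux Y0))"
    by (simp only: thetas A0[OF \<open>1 \<in> I\<close>] at_1 X0_def Y0_def s_def ramanujan_combination[OF assms])
  also have "\<dots> = 2 * (k + 1)^3 * (k^2 + 1) / pi"
    unfolding X0_def Y0_def s_def legendre_relation[OF assms] by simp
  finally have total: "C3 k * A3 1 + C2 k * A2 1 + C1 k * A1 1 + C0 k * A0 1
     = 2 * (k + 1)^3 * (k^2 + 1) / pi" .
  have "(\<lambda>n. a n * 1 ^ n) sums A0 1" "(\<lambda>n. real n * a n * 1 ^ n) sums A1 1"
    "(\<lambda>n. real n * (real n * a n) * 1 ^ n) sums A2 1"
    "(\<lambda>n. real n * (real n * (real n * a n)) * 1 ^ n) sums A3 1"
    unfolding A0_def A1_def A2_def A3_def using R(1)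
    by (intro summable_sums a_sum a1_sum a2_sum a3_sum; simp)+
  then have "(\<lambda>n. C3 k * (real n * (real n * (real n * a n)) * 1 ^ n) + C2 k * (real n * (real n * a n) * 1 ^ n)
      + C1 k * (real n * a n * 1 ^ n) + C0 k * (a n * 1 ^ n))
      sums (C3 k * A3 1 + C2 k * A2 1 + C1 k * A1 1 + C0 k * A0 1)"
    by (intro sums_add sums_mult)
  moreover have "(real ((2 * n) choose n))^2 * legendre_power_ext n k = a n" for n
  proof -
    have "(4 ^ n)^2 = (16 ^ n :: real)"
      by (simp flip: power_mult add: mult.commute[of n] power_mult)
    then show ?thesis
      unfolding legendre_power_ext_eq_csq[OF assms(1)] UV(1,2)[symmetric] a_def cbin2_def
      by (simp add: power_divide)
  qed
  ultimately show ?thesis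
    unfolding total by (simp add: eval_nat_numeral algebra_simps)
qed

end
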